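(* Let $g\in \mathrm{Diff}^2_\mu(\mathbf{T}^3)$ satisfy the following three conditions. (1) $g$ is ergodic with respect to $\mu$. (2) There is an equivariant fibration $\pi:\mathbf{T}^3\to\mathbf{T}^2$ such that $\pi g=A_2\pi$. The fibers of $\pi$ are the leaves of a foliation $\mathcal{W}^c_g$ of $\mathbf{T}^3$ by $C^2$ circles. In particular, the set of periodic leaves is dense in $\mathbf{T}^3$. (3) There exists $\lambda^c>0$ such that, for $\mu$-almost every $w\in\mathbf{T}^3$, if $0\neq v\in T_w\mathbf{T}^3$ is tangent to the leaf of $\mathcal{W}^c_g$ containing $w$, then $$\lim_{n\to\infty}\frac1n\log\|T_wg^n v\|=\lambda^c.$$ Then there exist a set $S\subseteq\mathbf{T}^3$ of full $\mu$-measure and an integer $k\in\mathbf{N}$, $k\ge 1$, such that $S$ meets every leaf of $\mathcal{W}^c_g$ in exactly $k$ points. (In this sense, the foliation $\mathcal{W}^c_g$ is absolutely singular.)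
   Context: $\mathbf{T}^d=\mathbf{R}^d/\mathbf{Z}^d$ is the $d$-torus. $\mu$ is Lebesgue–Haar measure on $\mathbf{T}^3$, and $\mathrm{Diff}^2_\mu(\mathbf{T}^3)$ is the set of $C^2$ diffeomorphisms of $\mathbf{T}^3$ that preserve $\mu$. $A_2$ is the automorphism of $\mathbf{T}^2$ given by the matrix $\begin{pmatrix}2&1\\1&1\end{pmatrix}$. A leaf is periodic if it is mapped to itself by some positive iterate of $g$. *)

theory Defs
  imports "HOL-Probability.Probability"
begin

section \<open>The torus as a quotient of Euclidean space\<close>

definition lattice_rel :: "real^'n \<Rightarrow> real^'n \<Rightarrow> bool" where
  "lattice_rel x y \<longleftrightarrow> (\<forall>i. x $ i - y $ i \<in> \<int>)"

lemma equivp_lattice_rel: "equivp lattice_rel"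
proof (rule equivpI)
  show "reflp lattice_rel"
    by (auto simp: reflp_def lattice_rel_def)
  show "symp lattice_rel"
    unfolding symp_def lattice_rel_def by (metis Ints_minus minus_diff_eq)
  show "transp lattice_rel"
    unfolding transp_def lattice_rel_def
  proof (intro allI impI)
    fix x y z :: "real^'n" and i
    assume "\<forall>i. x $ i - y $ i \<in> \<int>" "\<forall>i. y $ i - z $ i \<in> \<int>"
    then have "(x $ i - y $ i) + (y $ i - z $ i) \<in> \<int>"
      by (blast intro: Ints_add)
    then show "x $ i - z $ i \<in> \<int>" by simp
  qed
qed

quotient_type 'n torus = "real^('n::finite)" / lattice_rel
  morphisms rep_torus to_torus
  by (rule equivp_lattice_rel)

lemma to_torus_eq_iff: "to_torus x = to_torus y \<longleftrightarrow> (\<forall>i. x $ i - y $ i \<in> \<int>)"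
  by (simp add: torus.abs_eq_iff lattice_rel_def)

instantiation torus :: (finite) topological_space
begin

definition open_torus :: "'a torus set \<Rightarrow> bool" where
  "open_torus U \<longleftrightarrow> open (to_torus -` U)"

instance
  by standard (auto simp: open_torus_def vimage_Union)

end

text \<open>Lebesgue--Haar measure: the unit cube is a fundamental domain for the integer lattice.\<close>

definition haar :: "('n::finite) torus measure" where
  "haar = distr (restrict_space lborel {x. \<forall>i. 0 \<le> x $ i \<and> x $ i < 1}) borel to_torus"

lift_definition A2 :: "2 torus \<Rightarrow> 2 torus"
  is "\<lambda>x. (vector [vector [2, 1], vector [1, 1]] :: real^2^2) *v x"
proof -
  fix x y :: "real^2"
  assume "lattice_rel x y"
  then have 1: "x $ 1 - y $ 1 \<in> \<int>" and 2: "x $ 2 - y $ 2 \<in> \<int>"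
    by (auto simp: lattice_rel_def)
  have "2 * (x $ 1 - y $ 1) + (x $ 2 - y $ 2) \<in> \<int>" "(x $ 1 - y $ 1) + (x $ 2 - y $ 2) \<in> \<int>"
    using 1 2 by (blast intro: Ints_add Ints_mult Ints_numeral)+
  then show "lattice_rel ((vector [vector [2, 1], vector [1, 1]] :: real^2^2) *v x)
      ((vector [vector [2, 1], vector [1, 1]] :: real^2^2) *v y)"
    by (simp add: lattice_rel_def forall_2 matrix_vector_mult_def sum_2 algebra_simps)
qed

section \<open>Differentiability\<close>

text \<open>Twice continuously Frechet differentiable, for maps on an open set.\<close>

definition C2_on :: "'a::real_normed_vector set \<Rightarrow> ('a \<Rightarrow> 'b::real_normed_vector) \<Rightarrow> bool" where
  "C2_on U F \<longleftrightarrow> (\<exists>(F' :: 'a \<Rightarrow> 'a \<Rightarrow>\<^sub>L 'b) (F'' :: 'a \<Rightarrow> 'a \<Rightarrow>\<^sub>L ('a \<Rightarrow>\<^sub>L 'b)).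
     (\<forall>x\<in>U. (F has_derivative blinfun_apply (F' x)) (at x)) \<and>
     (\<forall>x\<in>U. (F' has_derivative blinfun_apply (F'' x)) (at x)) \<and>
     continuous_on U F'')"

text \<open>The charts of the torus are the local inverses of \<^const>\<open>to_torus\<close>, so a map between tori
  is read in charts as a local lift to Euclidean space. Translation identifies every tangent space
  of the torus with Euclidean space, carrying the flat metric to the Euclidean norm.\<close>

definition C2_torus :: "('m::finite torus \<Rightarrow> 'n::finite torus) \<Rightarrow> bool" where
  "C2_torus f \<longleftrightarrow> (\<forall>x. \<exists>U F. open U \<and> x \<in> U \<and> C2_on U F \<and>
     (\<forall>y\<in>U. to_torus (F y) = f (to_torus y)))"

definition torus_has_derivative ::
    "('m::finite torus \<Rightarrow> 'n::finite torus) \<Rightarrow> (real^'m \<Rightarrow> real^'n) \<Rightarrow> 'm torus \<Rightarrow> bool" where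
  "torus_has_derivative f D w \<longleftrightarrow> (\<exists>x F. to_torus x = w \<and>
     (\<forall>\<^sub>F y in nhds x. to_torus (F y) = f (to_torus y)) \<and> (F has_derivative D) (at x))"

lemma torus_has_derivative_unique:
  assumes "torus_has_derivative f D w" "torus_has_derivative f E w"
  shows "D = E"
proof -
  obtain x F where x: "to_torus x = w"
    and F: "\<forall>\<^sub>F y in nhds x. to_torus (F y) = f (to_torus y)"
    and D: "(F has_derivative D) (at x)"
    using assms(1) unfolding torus_has_derivative_def by blast
  obtain z G where z: "to_torus z = w"
    and G: "\<forall>\<^sub>F y in nhds z. to_torus (G y) = f (to_torus y)"
    and E: "(G has_derivative E) (at z)"
    using assms(2) unfolding torus_has_derivative_def by blast
  define m where "m = z - x"
  have "to_torus z = to_torus x" using x z by simp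
  then have m: "m $ i \<in> \<int>" for i
    by (simp add: m_def to_torus_eq_iff)
  have shift: "to_torus (y + m) = to_torus y" for y
    using m by (simp add: to_torus_eq_iff)
  have lim: "filterlim (\<lambda>y. y + m) (nhds z) (nhds x)"
    using tendsto_add[OF filterlim_ident[of "nhds x"] tendsto_const[of m "nhds x"]]
    by (simp add: m_def)
  have G': "\<forall>\<^sub>F y in nhds x. to_torus (G (y + m)) = f (to_torus y)"
    using eventually_compose_filterlim[OF G lim] by (simp add: shift)
  have E': "((\<lambda>y. G (y + m)) has_derivative E) (at x)"
    by (rule has_derivative_compose[where f = "\<lambda>y. y + m" and f' = "\<lambda>h. h", simplified])
       (use E in \<open>auto simp: m_def intro!: derivative_eq_intros\<close>)
  define H where "H = (\<lambda>y. F y - G (y + m))"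
  have H: "(H has_derivative (\<lambda>h. D h - E h)) (at x)"
    unfolding H_def by (intro has_derivative_diff D E')
  have int: "\<forall>\<^sub>F y in nhds x. \<forall>i. H y $ i \<in> \<int>"
    using F G'
  proof eventually_elim
    case (elim y)
    then have "to_torus (F y) = to_torus (G (y + m))" by simp
    then show ?case by (simp add: to_torus_eq_iff H_def)
  qed
  have "isCont H x" using H by (rule has_derivative_continuous)
  then have "(H \<longlongrightarrow> H x) (nhds x)"
    by (simp add: isCont_def tendsto_at_iff_tendsto_nhds)
  then have close: "\<forall>\<^sub>F y in nhds x. dist (H y) (H x) < 1"
    by (rule tendstoD) simp
  have const: "\<forall>\<^sub>F y in nhds x. H y = H x"
    using int close
  proof eventually_elim
    case (elim y)
    have "H y $ i = H x $ i" for i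
    proof -
      have "H y $ i - H x $ i \<in> \<int>"
        using elim(1) eventually_nhds_x_imp_x[OF int] by (auto intro: Ints_diff)
      moreover have "\<bar>H y $ i - H x $ i\<bar> < 1"
        using elim(2) component_le_norm_cart[of "H y - H x" i] by (simp add: dist_norm)
      ultimately show ?thesis using Ints_nonzero_abs_less1 by fastforce
    qed
    then show ?case by (simp add: vec_eq_iff)
  qed
  have "(H has_derivative (\<lambda>h. 0)) (at x)"
    by (rule has_derivative_transform_eventually[where f = "\<lambda>_. H x"])
       (use const in \<open>auto simp: eventually_at_filter elim: eventually_mono\<close>)
  then have "(\<lambda>h. D h - E h) = (\<lambda>h. 0)"
    using H has_derivative_unique by blast
  then show ?thesis by (auto simp: fun_eq_iff)
qed

definition torus_deriv ::
    "('m::finite torus \<Rightarrow> 'n::finite torus) \<Rightarrow> 'm torus \<Rightarrow> real^'m \<Rightarrow> real^'n" where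
  "torus_deriv f w = (THE D. torus_has_derivative f D w)"

lemma torus_deriv_eqI: "torus_has_derivative f D w \<Longrightarrow> torus_deriv f w = D"
  unfolding torus_deriv_def by (blast intro: the_equality torus_has_derivative_unique)

lemma C2_torus_has_derivative:
  assumes "C2_torus f"
  shows "torus_has_derivative f (torus_deriv f w) w"
proof -
  obtain x where x: "to_torus x = w"
    by (metis Quotient3_abs_rep Quotient3_torus)
  obtain U F where "open U" "x \<in> U" "C2_on U F" "\<forall>y\<in>U. to_torus (F y) = f (to_torus y)"
    using assms unfolding C2_torus_def by blast
  then have "\<exists>D. torus_has_derivative f D w"
    unfolding torus_has_derivative_def C2_on_def eventually_nhds using x by blast
  then show ?thesis using torus_deriv_eqI by metis
qed

section \<open>Dynamics\<close>

definition preserves_measure :: "'a measure \<Rightarrow> ('a \<Rightarrow> 'a) \<Rightarrow> bool" where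
  "preserves_measure M f \<longleftrightarrow> f \<in> measurable M M \<and> distr M M f = M"

definition ergodic :: "'a measure \<Rightarrow> ('a \<Rightarrow> 'a) \<Rightarrow> bool" where
  "ergodic M f \<longleftrightarrow> preserves_measure M f \<and>
     (\<forall>A\<in>sets M. f -` A \<inter> space M = A \<longrightarrow> emeasure M A = 0 \<or> emeasure M (space M - A) = 0)"

definition Diff2_haar :: "('n::finite torus \<Rightarrow> 'n torus) set" where
  "Diff2_haar = {g. bij g \<and> C2_torus g \<and> C2_torus (inv g) \<and> preserves_measure haar g}"

section \<open>Fibrations and foliations\<close>

text \<open>A locally trivial fibre bundle: over a neighbourhood of \<open>p\<close> it is a product with the fibre
  over \<open>p\<close>.\<close>

definition fibration :: "('a::topological_space \<Rightarrow> 'b::topological_space) \<Rightarrow> bool" where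
  "fibration \<pi> \<longleftrightarrow> surj \<pi> \<and> continuous_on UNIV \<pi> \<and>
     (\<forall>p. \<exists>U \<phi> \<psi>. open U \<and> p \<in> U \<and>
        homeomorphism (\<pi> -` U) (U \<times> \<pi> -` {p}) \<phi> \<psi> \<and> (\<forall>w\<in>\<pi> -` U. fst (\<phi> w) = \<pi> w))"

definition fibres :: "('a \<Rightarrow> 'b) \<Rightarrow> 'a set set" where
  "fibres \<pi> = range (\<lambda>p. \<pi> -` {p})"

text \<open>One-dimensional topological foliations of a three-dimensional manifold, given by their set
  of leaves. In a foliation chart, the connected components of the intersection of a leaf with the
  chart domain are plaques. No transverse regularity beyond continuity is required.\<close>

definition foliation_by_curves :: "'a::topological_space set set \<Rightarrow> bool" where
  "foliation_by_curves W \<longleftrightarrow> partition_on UNIV W \<and> (\<forall>L\<in>W. connected L) \<and>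
     (\<forall>w. \<exists>U (\<phi> :: 'a \<Rightarrow> (real^2) \<times> real) \<psi>. open U \<and> w \<in> U \<and>
        homeomorphism U (ball 0 1 \<times> {-1<..<1}) \<phi> \<psi> \<and>
        (\<forall>L\<in>W. \<forall>C\<in>components (L \<inter> U). \<exists>y\<in>ball 0 1. \<phi> ` C = {y} \<times> {-1<..<1}))"

text \<open>\<open>C\<^sup>2\<close> parametrisations of an embedded circle; by compactness an injective immersion of the
  circle is an embedding.\<close>

definition C2_circle_param :: "(1 torus \<Rightarrow> 'n::finite torus) \<Rightarrow> 'n torus set \<Rightarrow> bool" where
  "C2_circle_param \<gamma> L \<longleftrightarrow>
     C2_torus \<gamma> \<and> inj \<gamma> \<and> (\<forall>t. inj (torus_deriv \<gamma> t)) \<and> range \<gamma> = L"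

definition C2_circle :: "'n::finite torus set \<Rightarrow> bool" where
  "C2_circle L \<longleftrightarrow> (\<exists>\<gamma>. C2_circle_param \<gamma> L)"

definition circle_tangent_space :: "'n::finite torus set \<Rightarrow> 'n torus \<Rightarrow> (real^'n) set" where
  "circle_tangent_space L w =
     {torus_deriv \<gamma> t s | \<gamma> t s. C2_circle_param \<gamma> L \<and> \<gamma> t = w}"

definition periodic_leaf :: "('a \<Rightarrow> 'a) \<Rightarrow> 'a set \<Rightarrow> bool" where
  "periodic_leaf g L \<longleftrightarrow> (\<exists>n\<ge>1. (g ^^ n) ` L = L)"

end

theory Submission
  imports Defs
begin

text \<open>The fibres of \<open>\<pi>\<close> are permuted by \<open>g\<close>, which expands them almost everywhere at the exponential
  rate \<open>lambda_c > 0\<close>, so the inverse map contracts them. Distinct points of a fibre therefore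
  separate under \<open>g\<close>, but a compact space has room for only \<open>N\<close> points at mutual distance \<open>r\<close>: among
  more than \<open>N\<close> points of a fibre two are, at any given time, at distance less than \<open>r\<close>. If the
  inverse map contracts these two uniformly back to time \<open>0\<close>, and if this happens to the same two
  at arbitrarily late times, then they are equal. This pigeonhole argument is applied to the
  individual points of a fibre and takes the place of conditional measures on the fibres.

  To make it work, the expansion is measured by difference quotients rather than derivatives.
  \<open>expansion m w\<close> is the least factor (in logarithmic scale) by which \<open>g\<close> expands the distance from
  \<open>w\<close> to a point of the same fibre at distance less than \<open>1 / (m + 1)\<close>. It is a bounded Borel
  function and increases in \<open>m\<close>. Its limit is at least the logarithmic rate of \<open>Tg\<close> along the leaf
  (\<open>birkhoff_limit_expansion_ge\<close>), so that its Birkhoff sums grow at rate \<open>lambda_c\<close>. Hence the limit has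
  positive integral, and so has \<open>expansion m\<close> for some \<open>m\<close> (\<open>positive_expansion_integral\<close>). For
  this \<open>m\<close> the expansion holds on a whole neighbourhood of fixed size, without distortion estimates.

  The maximal ergodic inequality (\<open>maximal_ergodic\<close>) for the inverse map now provides a set \<open>H\<close> of
  positive measure whose points have backward orbits that accumulate expansion at a linear rate from
  the first step on; by induction along the backward orbit, fibre neighbourhoods of radius \<open>r\<close> of
  such points are contracted exponentially (\<open>backward_contraction\<close>). By ergodicity almost every point
  visits \<open>H\<close> with lower frequency at least some \<open>\<theta> > 0\<close> (\<open>birkhoff_sums_bounded_below\<close>). If a fibre
  contained more than \<open>N / \<theta>\<close> such points, then at arbitrarily late times more than \<open>N\<close> of them
  would be in \<open>H\<close> simultaneously, which is impossible by the pigeonhole argument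
  (\<open>card_frequent_visitors\<close>).

  So a set of full measure has finite fibres. Shrinking it to a suitable invariant set makes the
  number of points per fibre a measurable invariant function, which ergodicity forces to be a
  constant \<open>k\<close> almost everywhere (\<open>constant_fibre_card\<close>). The exceptional fibres together have
  measure zero, and in each of them the set may be replaced by any \<open>k\<close> points.\<close>

section \<open>The flat metric of the torus\<close>

lemma to_torus_rep: "to_torus (rep_torus a) = a"
  by (rule Quotient3_abs_rep[OF Quotient3_torus])

lemma to_torus_cases: obtains x where "a = to_torus x"
  by (metis to_torus_rep)

lemma abs_minus_round_cong:
  fixes s t :: real
  assumes "s - t \<in> \<int>"
  shows "s - of_int (round s) = t - of_int (round t)"
proof -
  obtain k where "s = t + of_int k"
    using assms by (metis Ints_cases add.commute diff_add_cancel)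
  moreover have "round (t + of_int k) = round t + k"
    unfolding round_def using floor_add_int[of "t + 1 / 2" k] by (simp add: algebra_simps)
  ultimately show ?thesis by simp
qed

instantiation torus :: (finite) metric_space
begin

text \<open>Rounding each coordinate of a difference of lifts to the nearest integer gives the shortest
  difference of lifts.\<close>

definition dist_torus :: "'a torus \<Rightarrow> 'a torus \<Rightarrow> real" where
  "dist_torus a b = norm (\<chi> i. (rep_torus a $ i - rep_torus b $ i)
      - of_int (round (rep_torus a $ i - rep_torus b $ i)))"

definition uniformity_torus :: "('a torus \<times> 'a torus) filter" where
  "uniformity_torus = (INF e\<in>{0<..}. principal {(x, y). dist x y < e})"

lemma dist_to_torus:
  "dist (to_torus x) (to_torus y) = norm (\<chi> i. (x $ i - y $ i) - of_int (round (x $ i - y $ i)))"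
proof -
  let ?x = "rep_torus (to_torus x)" and ?y = "rep_torus (to_torus y)"
  have "(?x $ i - ?y $ i) - (x $ i - y $ i) \<in> \<int>" for i
  proof -
    have "?x $ i - x $ i \<in> \<int>" "?y $ i - y $ i \<in> \<int>"
      using to_torus_eq_iff[of ?x x] to_torus_eq_iff[of ?y y] by (auto simp: to_torus_rep)
    then have "(?x $ i - x $ i) - (?y $ i - y $ i) \<in> \<int>" by (rule Ints_diff)
    then show ?thesis by (simp add: algebra_simps)
  qed
  then show ?thesis
    unfolding dist_torus_def
    by (intro arg_cong[where f = norm]) (auto simp: vec_eq_iff intro!: abs_minus_round_cong)
qed

lemma dist_to_torus_le: "dist (to_torus x) (to_torus y) \<le> dist x y"
  unfolding dist_to_torus dist_norm
  by (rule norm_le_componentwise_cart) (use round_diff_minimal[where m = 0] in auto)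

lemma dist_to_torus_attained:
  "\<exists>z. to_torus z = to_torus y \<and> dist (to_torus x) (to_torus y) = dist x z"
  by (rule exI[of _ "\<chi> i. y $ i + of_int (round (x $ i - y $ i))"])
     (auto simp: to_torus_eq_iff dist_to_torus dist_norm vec_eq_iff algebra_simps intro!: arg_cong[where f = norm])

lemma open_torus_iff_dist:
  "open (U :: 'a torus set) \<longleftrightarrow> (\<forall>a\<in>U. \<exists>e>0. \<forall>b. dist a b < e \<longrightarrow> b \<in> U)"
proof
  assume U: "open U"
  show "\<forall>a\<in>U. \<exists>e>0. \<forall>b. dist a b < e \<longrightarrow> b \<in> U"
  proof
    fix a assume "a \<in> U"
    obtain x where a: "a = to_torus x" by (rule to_torus_cases)
    have "open (to_torus -` U)" using U by (simp add: open_torus_def)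
    then obtain e where e: "e > 0" "\<And>y. dist y x < e \<Longrightarrow> y \<in> to_torus -` U"
      using \<open>a \<in> U\<close> a unfolding open_dist by (metis vimageI)
    have "b \<in> U" if d: "dist a b < e" for b
    proof -
      obtain y where b: "b = to_torus y" by (rule to_torus_cases)
      obtain z where "to_torus z = b" "dist x z < e"
        using d dist_to_torus_attained[of y x] unfolding a b by auto
      then show ?thesis using e(2)[of z] by (auto simp: dist_commute)
    qed
    then show "\<exists>e>0. \<forall>b. dist a b < e \<longrightarrow> b \<in> U" using e(1) by blast
  qed
next
  assume R: "\<forall>a\<in>U. \<exists>e>0. \<forall>b. dist a b < e \<longrightarrow> b \<in> U"
  show "open U"
    unfolding open_torus_def open_dist
  proof
    fix x assume "x \<in> to_torus -` U"
    then obtain e where "e > 0" "\<And>b. dist (to_torus x) b < e \<Longrightarrow> b \<in> U" using R by blast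
    then show "\<exists>e>0. \<forall>y. dist y x < e \<longrightarrow> y \<in> to_torus -` U"
      by (metis dist_commute dist_to_torus_le le_less_trans vimageI2)
  qed
qed

instance
proof
  show "uniformity = (INF e\<in>{0<..}. principal {(x :: 'a torus, y). dist x y < e})"
    by (rule uniformity_torus_def)
next
  fix U :: "'a torus set"
  have ev: "eventually P (uniformity :: ('a torus \<times> 'a torus) filter)
      \<longleftrightarrow> (\<exists>e>0. \<forall>x y. dist x y < e \<longrightarrow> P (x, y))" for P
    unfolding uniformity_torus_def
    by (subst eventually_INF_base)
       (auto simp: eventually_principal subset_eq intro: bexI[of _ "min _ _"])
  show "open U \<longleftrightarrow> (\<forall>x\<in>U. \<forall>\<^sub>F (x', y) in uniformity. x' = x \<longrightarrow> y \<in> U)"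
    unfolding open_torus_iff_dist ev by auto
next
  fix a b c :: "'a torus"
  obtain x where a: "a = to_torus x" by (rule to_torus_cases)
  obtain y where b: "b = to_torus y" by (rule to_torus_cases)
  show "dist a b = 0 \<longleftrightarrow> a = b"
  proof
    assume "dist a b = 0"
    then show "a = b" using dist_to_torus_attained[of y x] unfolding a b by auto
  next
    assume "a = b"
    then have "(x $ i - y $ i) - of_int (round (x $ i - y $ i)) = 0" for i
      using abs_minus_round_cong[of "x $ i - y $ i" 0] unfolding a b to_torus_eq_iff by simp
    then show "dist a b = 0" unfolding a b dist_to_torus
      by (simp add: vec_eq_iff)
  qed
  have comm: "dist b c = dist c b"
  proof -
    obtain z where c: "c = to_torus z" by (rule to_torus_cases)
    show ?thesis
      using dist_to_torus_attained[of z y] dist_to_torus_attained[of y z] dist_to_torus_le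
      unfolding b c by (metis dist_commute order_antisym)
  qed
  obtain z where c: "c = to_torus z" "dist a c = dist x z"
    using dist_to_torus_attained[of "rep_torus c" x] unfolding a to_torus_rep by metis
  obtain y' where b': "b = to_torus y'" "dist c b = dist z y'"
    using dist_to_torus_attained[of "rep_torus b" z] unfolding c to_torus_rep by metis
  have "dist a b \<le> dist x y'" unfolding a b'(1) by (rule dist_to_torus_le)
  also have "\<dots> \<le> dist a c + dist b c" using c b' comm by (metis dist_triangle)
  finally show "dist a b \<le> dist a c + dist b c" .
qed

end

lemma dist_to_torus_eq:
  assumes "dist x y < 1 / 2"
  shows "dist (to_torus x) (to_torus y) = dist x y"
proof -
  have "round (x $ i - y $ i) = 0" for i
    by (rule round_unique') (use assms component_le_norm_cart[of "x - y" i] in \<open>auto simp: dist_norm\<close>)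
  then show ?thesis
    unfolding dist_to_torus dist_norm by (intro arg_cong[where f = norm]) (auto simp: vec_eq_iff)
qed

lemma continuous_to_torus: "continuous_on S to_torus"
  unfolding continuous_on_iff by (metis dist_to_torus_le le_less_trans)

lemma compact_torus: "compact (UNIV :: 'n::finite torus set)"
proof -
  have "\<exists>x\<in>cbox 0 1. a = to_torus x" for a :: "'n torus"
  proof -
    obtain x where a: "a = to_torus x" by (rule to_torus_cases)
    have "to_torus (\<chi> i. frac (x $ i)) = to_torus x"
      by (auto simp: to_torus_eq_iff frac_def)
    moreover have "(\<chi> i. frac (x $ i)) \<in> cbox 0 1"
      by (auto simp: mem_box_cart frac_ge_0 less_imp_le[OF frac_lt_1])
    ultimately show ?thesis using a by metis
  qed
  then have "UNIV = to_torus ` (cbox 0 1 :: (real^'n) set)" by blast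
  then show ?thesis
    by (metis compact_cbox compact_continuous_image continuous_to_torus)
qed

instance torus :: (finite) perfect_space
proof
  fix a :: "'a torus"
  obtain x where a: "a = to_torus x" by (rule to_torus_cases)
  show "\<not> open {a}"
  proof
    assume "open {a}"
    then obtain e where e: "e > 0" "\<And>b. dist b a < e \<Longrightarrow> b = a"
      unfolding open_dist by auto
    obtain y :: "real^'a" where y: "y \<noteq> 0" "norm y < min e (1/2)"
    proof -
      obtain y :: "real^'a" where "norm y = min e (1/2) / 2"
        using vector_choose_size[of "min e (1/2) / 2"] e(1) by auto
      moreover have "min e (1/2) / 2 > 0" "min e (1/2) / 2 < min e (1/2)" using e(1) by auto
      ultimately show thesis using that[of y] by (metis norm_zero less_irrefl)
    qed
    have d: "dist (to_torus (x + y)) a = norm y"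
      unfolding a by (subst dist_to_torus_eq) (use y in \<open>auto simp: dist_norm\<close>)
    then have "to_torus (x + y) = a" using e(2) y(2) by auto
    then show False using d y(1) by simp
  qed
qed

section \<open>Differentiable maps of tori\<close>

lemma dist_to_torus_lift:
  obtains y where "b = to_torus y" "dist x y = dist (to_torus x) b"
  using dist_to_torus_attained[of "rep_torus b" x] by (metis to_torus_rep)

lemma C2_torus_continuous:
  fixes f :: "'m::finite torus \<Rightarrow> 'n::finite torus"
  assumes "C2_torus f"
  shows "continuous_on UNIV f"
  unfolding continuous_on_iff
proof (intro ballI allI impI)
  fix a :: "'m torus" and e :: real assume "e > 0"
  obtain x where a: "a = to_torus x" by (rule to_torus_cases)
  obtain U F where U: "open U" "x \<in> U" and "C2_on U F" and lift: "\<forall>y\<in>U. to_torus (F y) = f (to_torus y)"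
    using assms unfolding C2_torus_def by blast
  then have "isCont F x" unfolding C2_on_def by (meson has_derivative_continuous)
  then obtain d1 where d1: "d1 > 0" "\<And>y. dist y x < d1 \<Longrightarrow> dist (F y) (F x) < e"
    using \<open>e > 0\<close> unfolding continuous_at_eps_delta by blast
  obtain d2 where d2: "d2 > 0" "\<And>y. dist y x < d2 \<Longrightarrow> y \<in> U"
    using U unfolding open_dist by blast
  have "dist (f b) (f a) < e" if b: "dist b a < min d1 d2" for b
  proof -
    obtain y where y: "b = to_torus y" "dist x y = dist a b"
      unfolding a by (rule dist_to_torus_lift)
    then have "dist y x < d1" "dist y x < d2" using b by (auto simp: dist_commute)
    then have "y \<in> U" "dist (F y) (F x) < e" using d1 d2 by auto
    moreover have "dist (to_torus (F y)) (to_torus (F x)) \<le> dist (F y) (F x)"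
      by (rule dist_to_torus_le)
    moreover have "f b = to_torus (F y)" "f a = to_torus (F x)"
      using lift U(2) \<open>y \<in> U\<close> a y(1) by auto
    ultimately show ?thesis by simp
  qed
  then show "\<exists>d>0. \<forall>b\<in>UNIV. dist b a < d \<longrightarrow> dist (f b) (f a) < e"
    using d1(1) d2(1) by (intro exI[of _ "min d1 d2"]) auto
qed

lemma C2_torus_locally_lipschitz:
  fixes f :: "'m::finite torus \<Rightarrow> 'n::finite torus"
  assumes "C2_torus f"
  shows "\<exists>e>0. \<exists>L. \<forall>a b. dist a p < e \<and> dist b p < e \<longrightarrow> dist (f a) (f b) \<le> L * dist a b"
proof -
  obtain x where p: "p = to_torus x" by (rule to_torus_cases)
  obtain U F where U: "open U" "x \<in> U" and C2: "C2_on U F" and lift: "\<forall>y\<in>U. to_torus (F y) = f (to_torus y)"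
    using assms unfolding C2_torus_def by blast
  obtain F' F'' where F': "\<forall>y\<in>U. (F has_derivative blinfun_apply (F' y)) (at y)"
    and F'': "\<forall>y\<in>U. (F' has_derivative blinfun_apply (F'' y)) (at y)"
    using C2 unfolding C2_on_def by blast
  have "isCont F' x" using F'' U(2) by (meson has_derivative_continuous)
  then obtain d1 where d1: "d1 > 0" "\<And>y. dist y x < d1 \<Longrightarrow> dist (F' y) (F' x) < 1"
    using continuous_at_eps_delta[THEN iffD1, rule_format, of x F' 1] by auto
  obtain d2 where d2: "d2 > 0" "\<And>y. dist y x < d2 \<Longrightarrow> y \<in> U"
    using U unfolding open_dist by blast
  define e where "e = Min {d1, d2, 1/4}"
  have e: "e > 0" "e \<le> d1" "e \<le> d2" "e \<le> 1/4" using d1 d2 by (auto simp: e_def)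
  define L where "L = norm (F' x) + 1"
  have lip: "norm (F y - F z) \<le> L * norm (y - z)" if "y \<in> ball x e" "z \<in> ball x e" for y z
  proof (rule differentiable_bound[OF convex_ball _ _ that])
    fix u assume u: "u \<in> ball x e"
    then have "u \<in> U" using d2 e by (auto simp: dist_commute)
    then show "(F has_derivative blinfun_apply (F' u)) (at u within ball x e)"
      using F' has_derivative_at_withinI by blast
    have "dist (F' u) (F' x) < 1" using u d1 e by (auto simp: dist_commute)
    then have "norm (F' u) \<le> L"
      unfolding L_def dist_norm using norm_triangle_sub[of "F' u" "F' x"] by linarith
    then show "onorm (blinfun_apply (F' u)) \<le> L" by (simp add: norm_blinfun.rep_eq)
  qed
  have "dist (f a) (f b) \<le> L * dist a b" if ab: "dist a p < e" "dist b p < e" for a b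
  proof -
    obtain y where y: "a = to_torus y" "dist x y = dist p a"
      unfolding p by (rule dist_to_torus_lift)
    obtain z where z: "b = to_torus z" "dist x z = dist p b"
      unfolding p by (rule dist_to_torus_lift)
    have yz: "y \<in> ball x e" "z \<in> ball x e" using y z ab by (auto simp: dist_commute)
    have "dist y z \<le> dist y x + dist x z" by (rule dist_triangle)
    also have "\<dots> < 1/2" using yz e by (auto simp: dist_commute)
    finally have d: "dist a b = dist y z" unfolding y z by (rule dist_to_torus_eq)
    have "y \<in> U" "z \<in> U" using yz d2 e by (auto simp: dist_commute)
    then have "dist (f a) (f b) = dist (to_torus (F y)) (to_torus (F z))"
      using lift y z by auto
    also have "\<dots> \<le> dist (F y) (F z)" by (rule dist_to_torus_le)
    also have "\<dots> \<le> L * dist a b" using lip[OF yz] unfolding d dist_norm .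
    finally show ?thesis .
  qed
  then show ?thesis using e(1) by blast
qed

text \<open>Since \<open>f\<close> is bounded, pairs that violate ever larger Lipschitz constants approach the diagonal;
  at a limit point of them the local Lipschitz condition fails.\<close>

lemma locally_lipschitz_imp_lipschitz_compact:
  fixes f :: "'a::metric_space \<Rightarrow> 'b::metric_space"
  assumes "compact (UNIV :: 'a set)" "bounded (range f)"
    and loc: "\<And>p. \<exists>e>0. \<exists>L. \<forall>a b. dist a p < e \<and> dist b p < e \<longrightarrow> dist (f a) (f b) \<le> L * dist a b"
  shows "\<exists>L>0. \<forall>a b. dist (f a) (f b) \<le> L * dist a b"
proof (rule ccontr)
  assume neg: "\<not> ?thesis"
  have "\<forall>n. \<exists>p. dist (f (fst p)) (f (snd p)) > real (Suc n) * dist (fst p) (snd p)"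
  proof (intro allI, rule ccontr)
    fix n
    assume "\<nexists>p. dist (f (fst p)) (f (snd p)) > real (Suc n) * dist (fst p) (snd p)"
    then have "\<forall>a b. dist (f a) (f b) \<le> real (Suc n) * dist a b" by (force simp: not_less)
    moreover have "real (Suc n) > 0" by simp
    ultimately show False using neg by blast
  qed
  then obtain ab' where ab': "\<forall>n. dist (f (fst (ab' n))) (f (snd (ab' n)))
      > real (Suc n) * dist (fst (ab' n)) (snd (ab' n))"
    by (rule choice[THEN exE]) blast
  define a b where "a n = fst (ab' n)" and "b n = snd (ab' n)" for n
  have ab: "dist (f (a n)) (f (b n)) > real (Suc n) * dist (a n) (b n)" for n
    using ab' by (simp only: a_def b_def)
  obtain D where D: "\<And>x y. dist (f x) (f y) \<le> D"
  proof -
    obtain D where "\<forall>x\<in>range f. \<forall>y\<in>range f. dist x y \<le> D"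
      using assms(2) unfolding bounded_two_points by blast
    then show thesis using that[of D] by blast
  qed
  obtain p r where r: "strict_mono (r :: nat \<Rightarrow> nat)" and lim: "(\<lambda>n. a (r n)) \<longlonglongrightarrow> p"
    using assms(1)[unfolded compact_def, rule_format, of a] by (auto simp: comp_def)
  have le: "dist (a n) (b n) \<le> D * inverse (real (Suc n))" for n
  proof -
    have "real (Suc n) * dist (a n) (b n) \<le> D" using ab[of n] D less_imp_le order_trans by blast
    then show ?thesis by (simp add: field_simps)
  qed
  have "(\<lambda>n. dist (a n) (b n)) \<longlonglongrightarrow> 0"
  proof (rule tendsto_sandwich[OF _ _ tendsto_const])
    show "(\<lambda>n. D * inverse (real (Suc n))) \<longlonglongrightarrow> 0"
      by (rule tendsto_mult_right_zero[OF LIMSEQ_inverse_real_of_nat])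
    show "\<forall>\<^sub>F n in sequentially. dist (a n) (b n) \<le> D * inverse (real (Suc n))"
      by (intro always_eventually allI le)
  qed simp
  then have "(\<lambda>n. dist (a (r n)) (b (r n))) \<longlonglongrightarrow> 0"
    using LIMSEQ_subseq_LIMSEQ[OF _ r] by (simp add: comp_def)
  then have sum0: "(\<lambda>n. dist (a (r n)) p + dist (a (r n)) (b (r n))) \<longlonglongrightarrow> 0"
    using tendsto_add[OF tendsto_dist_iff[THEN iffD1, OF lim], of "\<lambda>n. dist (a (r n)) (b (r n))" 0] by simp
  have lim2: "(\<lambda>n. b (r n)) \<longlonglongrightarrow> p"
  proof (rule tendsto_dist_iff[THEN iffD2], rule tendsto_sandwich[OF _ _ tendsto_const sum0])
    show "\<forall>\<^sub>F n in sequentially. dist (b (r n)) p \<le> dist (a (r n)) p + dist (a (r n)) (b (r n))"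
      by (intro always_eventually allI) (metis add.commute dist_triangle3)
  qed simp
  obtain e L where e: "e > 0" and L: "\<And>a b. dist a p < e \<Longrightarrow> dist b p < e \<Longrightarrow> dist (f a) (f b) \<le> L * dist a b"
    using loc[of p] by blast
  have "\<forall>\<^sub>F n in sequentially. dist (a (r n)) p < e" using lim e by (rule tendstoD)
  moreover have "\<forall>\<^sub>F n in sequentially. dist (b (r n)) p < e" using lim2 e by (rule tendstoD)
  moreover have "\<forall>\<^sub>F n in sequentially. nat \<lceil>L\<rceil> \<le> n" by (rule eventually_ge_at_top)
  ultimately have "\<forall>\<^sub>F n in sequentially. False"
  proof eventually_elim
    case (elim n)
    have "L \<le> real (Suc (r n))" using elim(3) seq_suble[OF r, of n] by linarith
    then have "L * dist (a (r n)) (b (r n)) \<le> real (Suc (r n)) * dist (a (r n)) (b (r n))"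
      by (rule mult_right_mono) simp
    then show ?case using L[OF elim(1,2)] ab[of "r n"] by linarith
  qed
  then show False by simp
qed

lemma C2_torus_lipschitz:
  fixes f :: "'m::finite torus \<Rightarrow> 'n::finite torus"
  assumes "C2_torus f"
  shows "\<exists>L>0. \<forall>a b. dist (f a) (f b) \<le> L * dist a b"
  by (rule locally_lipschitz_imp_lipschitz_compact[OF compact_torus _ C2_torus_locally_lipschitz[OF assms]])
     (rule bounded_subset[OF compact_imp_bounded[OF compact_torus]], simp)

lemma torus_has_derivative_compose:
  assumes "torus_has_derivative f D w" "torus_has_derivative h E (f w)"
  shows "torus_has_derivative (h \<circ> f) (E \<circ> D) w"
proof -
  obtain x F where x: "to_torus x = w" and F: "\<forall>\<^sub>F y in nhds x. to_torus (F y) = f (to_torus y)"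
    and D: "(F has_derivative D) (at x)"
    using assms(1) unfolding torus_has_derivative_def by blast
  obtain z H where z: "to_torus z = f w" and H: "\<forall>\<^sub>F y in nhds z. to_torus (H y) = h (to_torus y)"
    and E: "(H has_derivative E) (at z)"
    using assms(2) unfolding torus_has_derivative_def by blast
  \<comment> \<open>The two lifts need not match at the base point; they differ there by a lattice vector.\<close>
  define m where "m = z - F x"
  have "to_torus (F x) = f w" using eventually_nhds_x_imp_x[OF F] x by simp
  then have "to_torus z = to_torus (F x)" using z by simp
  then have "m $ i \<in> \<int>" for i by (simp add: m_def to_torus_eq_iff)
  then have shift: "to_torus (y + m) = to_torus y" for y by (simp add: to_torus_eq_iff)
  have "isCont F x" using D by (rule has_derivative_continuous)
  then have "(F \<longlongrightarrow> F x) (nhds x)"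
    by (simp add: isCont_def tendsto_at_iff_tendsto_nhds)
  then have "filterlim (\<lambda>y. F y + m) (nhds z) (nhds x)"
    using tendsto_add[of F "F x" "nhds x" "\<lambda>_. m" m] by (simp add: m_def)
  then have "\<forall>\<^sub>F y in nhds x. to_torus (H (F y + m)) = h (to_torus (F y + m))"
    by (rule eventually_compose_filterlim[OF H])
  then have "\<forall>\<^sub>F y in nhds x. to_torus (H (F y + m)) = (h \<circ> f) (to_torus y)"
    using F by eventually_elim (simp add: shift)
  moreover have "((\<lambda>y. H (F y + m)) has_derivative (\<lambda>v. E (D v))) (at x)"
  proof (rule has_derivative_compose[where f = "\<lambda>y. F y + m"])
    show "((\<lambda>y. F y + m) has_derivative D) (at x)"
      using has_derivative_add[OF D has_derivative_const[of m]] by simp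
    show "(H has_derivative E) (at (F x + m))" using E by (simp add: m_def)
  qed
  ultimately show ?thesis unfolding torus_has_derivative_def using x by (auto simp: comp_def)
qed

text \<open>This turns derivatives along a leaf into statements about distances. It holds without error
  terms because a lift of a short curve is isometric to the curve.\<close>

lemma torus_curve_speed:
  fixes f :: "1 torus \<Rightarrow> 'n::finite torus"
  assumes "torus_has_derivative f D t"
  shows "((\<lambda>s. dist (f s) (f t) / dist s t) \<longlongrightarrow> norm (D 1)) (at t)"
proof (rule metric_LIM_I)
  fix e :: real assume "e > 0"
  obtain x F where t: "to_torus x = t" and F: "\<forall>\<^sub>F y in nhds x. to_torus (F y) = f (to_torus y)"
    and D: "(F has_derivative D) (at x)"
    using assms unfolding torus_has_derivative_def by blast
  obtain d1 where d1: "d1 > 0" "\<And>y. dist y x < d1 \<Longrightarrow> to_torus (F y) = f (to_torus y)"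
    using F unfolding eventually_nhds_metric by blast
  have "isCont F x" using D by (rule has_derivative_continuous)
  then obtain d2 where d2: "d2 > 0" "\<And>y. dist y x < d2 \<Longrightarrow> dist (F y) (F x) < 1/2"
    using continuous_at_eps_delta[THEN iffD1, rule_format, of x F "1/2"] by auto
  obtain d3 where d3: "d3 > 0"
    "\<And>y. norm (y - x) < d3 \<Longrightarrow> norm (F y - F x - D (y - x)) \<le> e/2 * norm (y - x)"
    using D \<open>e > 0\<close> unfolding has_derivative_at_alt by (meson half_gt_zero)
  have lin: "bounded_linear D" using D by (rule has_derivative_bounded_linear)
  have normD: "norm (D v) = norm v * norm (D 1)" for v :: "real^1"
  proof -
    have "v = (v $ 1) *\<^sub>R 1" by (simp add: vec_eq_iff)
    then have "D v = D ((v $ 1) *\<^sub>R 1)" by (rule arg_cong)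
    also have "\<dots> = (v $ 1) *\<^sub>R D 1" by (rule linear_cmul[OF bounded_linear.linear[OF lin]])
    finally have "D v = (v $ 1) *\<^sub>R D 1" .
    then show ?thesis by (simp add: norm_real)
  qed
  have "dist (dist (f s) (f t) / dist s t) (norm (D 1)) < e"
    if s: "s \<noteq> t" "dist s t < Min {d1, d2, d3}" for s
  proof -
    obtain y where y: "s = to_torus y" "dist x y = dist t s"
      using dist_to_torus_lift[of s x] unfolding t by blast
    define q where "q = norm (y - x)"
    have q: "q = dist s t" using y by (simp add: q_def dist_norm norm_minus_commute dist_commute)
    have q0: "q > 0" using q s(1) by simp
    have close: "dist y x < d1" "dist y x < d2" "norm (y - x) < d3"
      using s(2) y(2) by (auto simp: dist_commute dist_norm norm_minus_commute)
    have "f s = to_torus (F y)" "f t = to_torus (F x)"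
      using d1(2)[OF close(1)] d1(2)[of x] d1(1) y(1) t by auto
    then have fd: "dist (f s) (f t) = norm (F y - F x)"
      using dist_to_torus_eq[OF d2(2)[OF close(2)]] by (simp add: dist_norm)
    have "\<bar>norm (F y - F x) - q * norm (D 1)\<bar> \<le> e/2 * q"
      using order_trans[OF norm_triangle_ineq3 d3(2)[OF close(3)]] normD[of "y - x"]
      unfolding q_def by simp
    then have "\<bar>(norm (F y - F x) - q * norm (D 1)) / q\<bar> \<le> e/2"
      using q0 by (simp add: abs_divide pos_divide_le_eq)
    moreover have "(norm (F y - F x) - q * norm (D 1)) / q = norm (F y - F x) / q - norm (D 1)"
      using q0 by (simp add: diff_divide_distrib)
    ultimately show ?thesis using \<open>e > 0\<close> unfolding fd q[symmetric] dist_real_def by simp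
  qed
  then show "\<exists>d>0. \<forall>s. s \<noteq> t \<and> dist s t < d \<longrightarrow> dist (dist (f s) (f t) / dist s t) (norm (D 1)) < e"
    using d1(1) d2(1) d3(1) by (intro exI[of _ "Min {d1, d2, d3}"]) auto
qed

section \<open>One-sided ergodic averages\<close>

definition birkhoff_sum :: "('a \<Rightarrow> 'a) \<Rightarrow> ('a \<Rightarrow> real) \<Rightarrow> nat \<Rightarrow> 'a \<Rightarrow> real" where
  "birkhoff_sum T f n w = (\<Sum>j<n. f ((T ^^ j) w))"

lemma birkhoff_sum_0 [simp]: "birkhoff_sum T f 0 w = 0"
  by (simp add: birkhoff_sum_def)

lemma birkhoff_sum_Suc: "birkhoff_sum T f (Suc n) w = f w + birkhoff_sum T f n (T w)"
  unfolding birkhoff_sum_def by (subst sum.lessThan_Suc_shift) (simp add: funpow_swap1)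

lemma birkhoff_sum_diff_const:
  "birkhoff_sum T (\<lambda>w. f w - c) n w = birkhoff_sum T f n w - real n * c"
  by (simp add: birkhoff_sum_def sum_subtractf)

lemma birkhoff_sum_uminus: "birkhoff_sum T (\<lambda>w. - f w) n w = - birkhoff_sum T f n w"
  by (simp add: birkhoff_sum_def sum_negf)

lemma measurable_funpow:
  "T \<in> measurable M M \<Longrightarrow> T ^^ n \<in> measurable M M"
  by (induction n) (auto simp: id_def[symmetric])

lemma measurable_birkhoff_sum:
  assumes "T \<in> measurable M M" "f \<in> borel_measurable M"
  shows "birkhoff_sum T f n \<in> borel_measurable M"
  unfolding birkhoff_sum_def[abs_def]
  using measurable_compose[OF measurable_funpow[OF assms(1)] assms(2)] by simp

lemma integral_preserved:
  fixes f :: "'a \<Rightarrow> real"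
  assumes "preserves_measure M T" "f \<in> borel_measurable M"
  shows "(\<integral>w. f (T w) \<partial>M) = (\<integral>w. f w \<partial>M)"
  using integral_distr[of T M M f] assms by (simp add: preserves_measure_def)

lemma integrable_preserved:
  fixes f :: "'a \<Rightarrow> real"
  assumes "preserves_measure M T" "integrable M f"
  shows "integrable M (\<lambda>w. f (T w))"
  using integrable_distr_eq[of T M M f] assms by (auto simp: preserves_measure_def)

text \<open>The maximum of the Birkhoff sums of length at most \<open>n\<close>, the empty sum included.\<close>

fun max_birkhoff :: "('a \<Rightarrow> 'a) \<Rightarrow> ('a \<Rightarrow> real) \<Rightarrow> nat \<Rightarrow> 'a \<Rightarrow> real" where
  "max_birkhoff T f 0 w = 0"
| "max_birkhoff T f (Suc n) w = max 0 (f w + max_birkhoff T f n (T w))"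

lemma max_birkhoff_nonneg: "0 \<le> max_birkhoff T f n w"
  by (cases n) auto

lemma max_birkhoff_mono: "max_birkhoff T f n w \<le> max_birkhoff T f (Suc n) w"
proof (induction n arbitrary: w)
  case (Suc n)
  show ?case using Suc[of "T w"] by (subst (1 2) max_birkhoff.simps) linarith
qed simp

lemma birkhoff_sum_le_max: "birkhoff_sum T f n w \<le> max_birkhoff T f n w"
proof (induction n arbitrary: w)
  case (Suc n)
  show ?case using Suc[of "T w"] by (auto simp: birkhoff_sum_Suc)
qed simp

lemma integrable_max_birkhoff:
  assumes "preserves_measure M T" "integrable M f"
  shows "integrable M (max_birkhoff T f n)"
proof (induction n)
  case (Suc n)
  have "integrable M (\<lambda>w. max 0 (f w + max_birkhoff T f n (T w)))"
    by (intro integrable_max Bochner_Integration.integrable_add assms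
        integrable_preserved[OF assms(1) Suc]) simp
  then show ?case by simp
qed simp

text \<open>Garsia's argument: where the maximum \<open>m\<close> is positive it equals \<open>f\<close> plus a maximum along the
  shifted orbit, so \<open>f \<ge> m - m \<circ> T\<close> there, and the right-hand side has integral zero.\<close>

theorem maximal_ergodic:
  assumes T: "preserves_measure M T" and f: "integrable M f"
    and pos: "AE w in M. \<exists>n. birkhoff_sum T f n w > 0"
  shows "0 \<le> (\<integral>w. f w \<partial>M)"
proof -
  define m where "m = max_birkhoff T f"
  define fn where "fn n w = f w * indicator {w. m n w > 0} w" for n w
  have int_m: "integrable M (m n)" for n
    unfolding m_def using integrable_max_birkhoff[OF T f] .
  then have meas_m [measurable]: "m n \<in> borel_measurable M" for n by simp
  have meas_f [measurable]: "f \<in> borel_measurable M" using f by simp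
  have meas_fn [measurable]: "fn n \<in> borel_measurable M" for n
  proof -
    have "fn n = (\<lambda>w. if m n w > 0 then f w else 0)" by (auto simp: fn_def)
    then show ?thesis by simp
  qed
  have int_fn: "integrable M (fn n)" for n
    by (rule Bochner_Integration.integrable_bound[OF f]) (auto simp: fn_def indicator_def)
  have nonneg: "0 \<le> (\<integral>w. fn n w \<partial>M)" for n
  proof -
    have "m n w - m n (T w) \<le> fn n w" for w
    proof (cases "m n w > 0")
      case True
      then obtain k where k: "n = Suc k" by (cases n) (auto simp: m_def)
      then have "m n w = f w + m k (T w)" using True by (auto simp: m_def max_def split: if_splits)
      moreover have "m k (T w) \<le> m n (T w)" unfolding k m_def by (rule max_birkhoff_mono)
      ultimately show ?thesis using True by (simp add: fn_def)
    next
      case False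
      then show ?thesis using max_birkhoff_nonneg[of T f n "T w"] by (simp add: fn_def m_def)
    qed
    then have "(\<integral>w. m n w - m n (T w) \<partial>M) \<le> (\<integral>w. fn n w \<partial>M)"
      by (intro integral_mono int_fn Bochner_Integration.integrable_diff int_m
          integrable_preserved[OF T int_m]) auto
    moreover have "(\<integral>w. m n w - m n (T w) \<partial>M) = 0"
      using Bochner_Integration.integral_diff[OF int_m integrable_preserved[OF T int_m]]
        integral_preserved[OF T meas_m] by simp
    ultimately show ?thesis by simp
  qed
  have "(\<lambda>n. \<integral>w. fn n w \<partial>M) \<longlonglongrightarrow> (\<integral>w. f w \<partial>M)"
  proof (rule integral_dominated_convergence[where w = "\<lambda>w. \<bar>f w\<bar>"])
    show "AE w in M. (\<lambda>n. fn n w) \<longlonglongrightarrow> f w"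
      using pos
    proof eventually_elim
      case (elim w)
      then obtain n0 where "birkhoff_sum T f n0 w > 0" by blast
      then have "m n0 w > 0" using birkhoff_sum_le_max[of T f n0 w] by (simp add: m_def)
      moreover have "m n0 w \<le> m n w" if "n \<ge> n0" for n
        using that lift_Suc_mono_le[of "\<lambda>n. m n w"] max_birkhoff_mono unfolding m_def by metis
      ultimately have "fn n w = f w" if "n \<ge> n0" for n
        using that by (fastforce simp: fn_def)
      then have "\<forall>\<^sub>F n in sequentially. fn n w = f w" by (auto simp: eventually_sequentially)
      then show ?case by (rule tendsto_eventually)
    qed
    show "AE w in M. norm (fn n w) \<le> \<bar>f w\<bar>" for n
      by (auto simp: fn_def indicator_def)
  qed (use f in auto)
  then show ?thesis by (rule LIMSEQ_le_const) (use nonneg in auto)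
qed

corollary nonneg_birkhoff_sums_not_null:
  assumes "preserves_measure M T" "integrable M f" "0 < (\<integral>w. f w \<partial>M)"
  shows "\<not> (AE w in M. \<not> (\<forall>n. 0 \<le> birkhoff_sum T f n w))"
proof
  assume "AE w in M. \<not> (\<forall>n. 0 \<le> birkhoff_sum T f n w)"
  then have "AE w in M. \<exists>n. birkhoff_sum T (\<lambda>w. - f w) n w > 0"
    by (auto simp: birkhoff_sum_uminus not_le)
  then have "0 \<le> (\<integral>w. - f w \<partial>M)"
    using assms(1,2) by (intro maximal_ergodic) auto
  then show False using assms(3) by simp
qed

lemma ergodic_zero_one:
  assumes "ergodic M T" "A \<in> sets M" "T -` A \<inter> space M = A"
  shows "(AE w in M. w \<notin> A) \<or> (AE w in M. w \<in> A)"
proof -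
  consider "emeasure M A = 0" | "emeasure M (space M - A) = 0"
    using assms unfolding ergodic_def by blast
  then show ?thesis
  proof cases
    case 1
    then have "A \<in> null_sets M" using assms(2) by blast
    then show ?thesis using AE_not_in by blast
  next
    case 2
    then have "space M - A \<in> null_sets M" using assms(2) by blast
    then have "AE w in M. w \<notin> space M - A" by (rule AE_not_in)
    then have "AE w in M. w \<in> A" using AE_space by eventually_elim auto
    then show ?thesis by blast
  qed
qed

text \<open>This is the half of the pointwise ergodic theorem that follows from the maximal inequality
  alone: the set of points with Birkhoff sums unbounded below is invariant, and it is not of full
  measure because some Birkhoff sum is negative at each of its points.\<close>

theorem birkhoff_sums_bounded_below:
  assumes erg: "ergodic M T" and f: "integrable M f" and pos: "0 < (\<integral>w. f w \<partial>M)"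
  shows "AE w in M. \<exists>K. \<forall>n. - K \<le> birkhoff_sum T f n w"
proof -
  have T: "preserves_measure M T" using erg by (simp add: ergodic_def)
  then have Tm [measurable]: "T \<in> measurable M M" by (simp add: preserves_measure_def)
  have [measurable]: "birkhoff_sum T f n \<in> borel_measurable M" for n
    using measurable_birkhoff_sum[OF Tm] f by auto
  define B where "B = {w \<in> space M. \<forall>K::nat. \<exists>n. birkhoff_sum T f n w < - real K}"
  have iff: "(\<forall>K::nat. \<exists>n. birkhoff_sum T f n w < - real K)
      \<longleftrightarrow> (\<forall>K. \<exists>n. birkhoff_sum T f n w < - K)" for w
  proof (intro iffI allI)
    fix K :: real assume unbdd: "\<forall>K::nat. \<exists>n. birkhoff_sum T f n w < - real K"
    obtain k :: nat where "K < k" using reals_Archimedean2 by blast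
    moreover obtain n where "birkhoff_sum T f n w < - real k" using unbdd by blast
    ultimately show "\<exists>n. birkhoff_sum T f n w < - K" by (intro exI[of _ n]) linarith
  qed auto
  have "T -` B \<inter> space M = B"
  proof (intro equalityI subsetI)
    fix w assume w: "w \<in> T -` B \<inter> space M"
    have "\<exists>n. birkhoff_sum T f n w < - K" for K
    proof -
      obtain n where "birkhoff_sum T f n (T w) < - (K + f w)"
        using w iff unfolding B_def by blast
      then have "birkhoff_sum T f (Suc n) w < - K" by (simp add: birkhoff_sum_Suc)
      then show ?thesis by blast
    qed
    then show "w \<in> B" using w unfolding B_def iff by blast
  next
    fix w assume w: "w \<in> B"
    have "\<exists>n. birkhoff_sum T f n (T w) < - K" for K
    proof -
      obtain n where n: "birkhoff_sum T f n w < - max 0 (K - f w)"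
        using w iff unfolding B_def by blast
      then obtain k where "n = Suc k" by (cases n) auto
      then have "birkhoff_sum T f k (T w) < - K" using n by (simp add: birkhoff_sum_Suc)
      then show ?thesis by blast
    qed
    then show "w \<in> T -` B \<inter> space M"
      using w measurable_space[OF Tm] unfolding B_def iff by blast
  qed
  moreover have "B \<in> sets M" unfolding B_def by measurable
  ultimately consider "AE w in M. w \<notin> B" | "AE w in M. w \<in> B"
    using ergodic_zero_one[OF erg] by blast
  then show ?thesis
  proof cases
    case 1
    show ?thesis using 1 AE_space
      by eventually_elim (auto simp: B_def not_less)
  next
    case 2
    have "AE w in M. \<not> (\<forall>n. 0 \<le> birkhoff_sum T f n w)"
      using 2
    proof eventually_elim
      case (elim w)
      then obtain n where "birkhoff_sum T f n w < - real 0" unfolding B_def by blast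
      then show ?case by (auto simp: not_le)
    qed
    then show ?thesis
      using nonneg_birkhoff_sums_not_null[OF T f pos] by blast
  qed
qed

section \<open>Expansion along the fibres\<close>

lemma separated_card_bound:
  assumes "compact (UNIV :: 'a::metric_space set)" "r > 0"
  shows "\<exists>N. \<forall>X :: 'a set. (\<forall>x\<in>X. \<forall>y\<in>X. x \<noteq> y \<longrightarrow> r \<le> dist x y) \<longrightarrow> card X \<le> N"
proof -
  obtain C :: "'a set" where C: "finite C" "UNIV \<subseteq> (\<Union>x\<in>C. ball x (r/2))"
    using compact_imp_seq_compact[OF assms(1), THEN seq_compact_imp_totally_bounded] assms(2)
    by (metis half_gt_zero)
  then have "\<forall>x. \<exists>c. c \<in> C \<and> dist c x < r/2" by (auto simp: subset_eq)
  then obtain c where c: "\<forall>x. c x \<in> C \<and> dist (c x) x < r/2" by (rule choice[THEN exE]) blast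
  have "card X \<le> card C" if X: "\<forall>x\<in>X. \<forall>y\<in>X. x \<noteq> y \<longrightarrow> r \<le> dist x y" for X :: "'a set"
  proof (rule card_inj_on_le[OF _ _ C(1)])
    show "inj_on c X"
    proof (rule inj_onI, rule ccontr)
      fix x y assume xy: "x \<in> X" "y \<in> X" "c x = c y" "x \<noteq> y"
      have "dist x y \<le> dist (c x) x + dist (c x) y" by (rule dist_triangle3)
      moreover have "dist (c x) x < r/2" "dist (c x) y < r/2" using c xy(3) by metis+
      ultimately have "dist x y < r" by linarith
      then show False using X xy by force
    qed
  qed (use c in auto)
  then show ?thesis by blast
qed

text \<open>The smooth structure enters the argument only through Lipschitz constants and the growth of the
  expansion along typical orbits. Everything else concerns distances between points of a fibre, and this is the setting for
  it. One constant \<open>L\<close> serves both directions so that logarithms of ratios lie in a symmetric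
  interval.\<close>

locale fibred_dynamics =
  fixes g :: "'a::metric_space \<Rightarrow> 'a" and \<pi> :: "'a \<Rightarrow> 'b::t2_space" and L :: real
  assumes compact_space: "compact (UNIV :: 'a set)"
    and bij_g: "bij g"
    and L_ge_1: "1 \<le> L"
    and lipschitz_g: "\<And>a b. dist (g a) (g b) \<le> L * dist a b"
    and lipschitz_inv_g: "\<And>a b. dist a b \<le> L * dist (g a) (g b)"
    and continuous_proj: "continuous_on UNIV \<pi>"
    and fibre_iff: "\<And>a b. \<pi> (g a) = \<pi> (g b) \<longleftrightarrow> \<pi> a = \<pi> b"
begin

definition log_ratio :: "'a \<Rightarrow> 'a \<Rightarrow> real" where
  "log_ratio w w' = ln (dist (g w) (g w') / dist w w')"

text \<open>The least expansion of distances from \<open>w\<close> to points of its fibre closer than \<open>1 / (m + 1)\<close>.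
  Inserting the upper bound \<open>ln L\<close> keeps the infimum meaningful at isolated points of a fibre. As
  \<open>m\<close> grows this increases to the lower rate at which \<open>g\<close> infinitesimally expands the fibre at
  \<open>w\<close>, capped at \<open>ln L\<close>.\<close>

definition expansion :: "nat \<Rightarrow> 'a \<Rightarrow> real" where
  "expansion m w = Inf (insert (ln L)
     {log_ratio w w' | w'. \<pi> w' = \<pi> w \<and> w' \<noteq> w \<and> dist w w' < 1 / real (Suc m)})"

definition limit_expansion :: "'a \<Rightarrow> real" where
  "limit_expansion w = (SUP m. expansion m w)"

lemma inj_g: "inj g"
  using bij_g by (rule bij_is_inj)

lemma inv_g_g [simp]: "inv g (g w) = w"
  by (rule inv_f_f[OF inj_g])

lemma g_inv_g [simp]: "g (inv g w) = w"
  by (rule surj_f_inv_f[OF bij_is_surj[OF bij_g]])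

lemma inv_funpow_funpow: "(inv g ^^ j) ((g ^^ j) w) = w"
proof (induction j)
  case (Suc j)
  have "(inv g ^^ Suc j) ((g ^^ Suc j) w) = (inv g ^^ j) (inv g (g ((g ^^ j) w)))"
    by (simp only: funpow_Suc_right[of j "inv g"] funpow.simps(2)[of j g] comp_apply)
  then show ?case using Suc by simp
qed simp

lemma continuous_g: "continuous_on UNIV g"
  unfolding continuous_on_iff
proof (intro ballI allI impI)
  fix x and e :: real assume "e > 0"
  have "dist (g y) (g x) < e" if "dist y x < e / L" for y
  proof -
    have "L * dist y x < e" using that L_ge_1 by (simp add: pos_less_divide_eq mult.commute)
    then show ?thesis using lipschitz_g[of y x] by linarith
  qed
  then show "\<exists>d>0. \<forall>y\<in>UNIV. dist y x < d \<longrightarrow> dist (g y) (g x) < e"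
    using \<open>e > 0\<close> L_ge_1 by (intro exI[of _ "e / L"]) auto
qed

lemma log_ratio_bounds:
  assumes "w' \<noteq> w"
  shows "log_ratio w w' \<le> ln L" "- ln L \<le> log_ratio w w'"
proof -
  have d: "dist w w' > 0" "dist (g w) (g w') > 0" using assms inj_g by (auto dest: injD)
  show "log_ratio w w' \<le> ln L"
    unfolding log_ratio_def using d L_ge_1 lipschitz_g[of w w']
    by (intro ln_mono) (auto simp: pos_divide_le_eq)
  have "ln (dist w w' / dist (g w) (g w')) \<le> ln L"
    using d L_ge_1 lipschitz_inv_g[of w w'] by (intro ln_mono) (auto simp: pos_divide_le_eq)
  then show "- ln L \<le> log_ratio w w'"
    unfolding log_ratio_def using d by (simp add: ln_div)
qed

lemma bdd_below_log_ratios: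
  "bdd_below (insert (ln L)
     {log_ratio w w' | w'. \<pi> w' = \<pi> w \<and> w' \<noteq> w \<and> dist w w' < 1 / real (Suc m)})"
proof (rule bdd_belowI)
  fix x assume "x \<in> insert (ln L)
     {log_ratio w w' | w'. \<pi> w' = \<pi> w \<and> w' \<noteq> w \<and> dist w w' < 1 / real (Suc m)}"
  moreover have "0 \<le> ln L" using L_ge_1 by simp
  ultimately show "- ln L \<le> x" using log_ratio_bounds(2) by auto
qed

lemma expansion_greatest:
  assumes "c \<le> ln L"
    and "\<And>w'. \<pi> w' = \<pi> w \<Longrightarrow> w' \<noteq> w \<Longrightarrow> dist w w' < 1 / real (Suc m) \<Longrightarrow> c \<le> log_ratio w w'"
  shows "c \<le> expansion m w"
  unfolding expansion_def by (rule cInf_greatest) (use assms in auto)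

lemma expansion_le_ln_L: "expansion m w \<le> ln L"
  unfolding expansion_def by (intro cInf_lower bdd_below_log_ratios) simp

lemma expansion_lower:
  assumes "\<pi> w' = \<pi> w" "w' \<noteq> w" "dist w w' < 1 / real (Suc m)"
  shows "expansion m w \<le> log_ratio w w'"
  unfolding expansion_def by (intro cInf_lower bdd_below_log_ratios) (use assms in auto)

lemma expansion_ge: "- ln L \<le> expansion m w"
  by (rule expansion_greatest) (use L_ge_1 log_ratio_bounds(2) in auto)

lemma abs_expansion_le: "\<bar>expansion m w\<bar> \<le> ln L"
  using expansion_le_ln_L[of m w] expansion_ge[of m w] by linarith

lemma expansion_mono: "expansion m w \<le> expansion (Suc m) w"
proof (rule expansion_greatest[OF expansion_le_ln_L])
  fix w' assume w': "\<pi> w' = \<pi> w" "w' \<noteq> w" "dist w w' < 1 / real (Suc (Suc m))"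
  moreover have "1 / real (Suc (Suc m)) \<le> 1 / real (Suc m)" by (simp add: frac_le)
  ultimately show "expansion m w \<le> log_ratio w w'" by (intro expansion_lower) auto
qed

lemma bdd_above_expansion: "bdd_above (range (\<lambda>m. expansion m w))"
  using expansion_le_ln_L by (intro bdd_aboveI[of _ "ln L"]) auto

lemma expansion_le_limit: "expansion m w \<le> limit_expansion w"
  unfolding limit_expansion_def by (rule cSUP_upper[OF UNIV_I bdd_above_expansion])

lemma expansion_tendsto_limit: "(\<lambda>m. expansion m w) \<longlonglongrightarrow> limit_expansion w"
  unfolding limit_expansion_def
  by (rule LIMSEQ_incseq_SUP[OF bdd_above_expansion]) (rule incseq_SucI, rule expansion_mono)

lemma expansion_dist_le:
  assumes "\<pi> w' = \<pi> w" "dist w w' < 1 / real (Suc m)"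
  shows "exp (expansion m w) * dist w w' \<le> dist (g w) (g w')"
proof (cases "w' = w")
  case False
  then have d: "dist w w' > 0" "dist (g w) (g w') > 0" using inj_g by (auto dest: injD)
  then have "exp (expansion m w) \<le> exp (log_ratio w w')"
    using expansion_lower[OF assms(1) False assms(2)] by simp
  also have "\<dots> = dist (g w) (g w') / dist w w'"
    unfolding log_ratio_def using d by simp
  finally show ?thesis using d by (simp add: pos_le_divide_eq)
qed simp

text \<open>The points at which the infimum is below \<open>a\<close> form a countable union of projections of compact
  sets of pairs: each of the strict inequalities is exhausted by closed ones.\<close>

lemma measurable_expansion: "expansion m \<in> borel_measurable borel"
proof (rule borel_measurable_iff_less[THEN iffD2], rule allI)
  fix a :: real
  define e where "e i = 1 / real (Suc i)" for i
  define K where "K i = {z. \<pi> (snd z) = \<pi> (fst z) \<and> e i \<le> dist (fst z) (snd z) \<and>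
      dist (fst z) (snd z) \<le> e m - e i \<and>
      dist (g (fst z)) (g (snd z)) \<le> exp (a - e i) * dist (fst z) (snd z)}" for i
  have e: "e i > 0" for i by (simp add: e_def)
  have e0: "e \<longlonglongrightarrow> 0" unfolding e_def using LIMSEQ_inverse_real_of_nat by (simp add: inverse_eq_divide)
  show "{w \<in> space borel. expansion m w < a} \<in> sets borel"
  proof (cases "a \<le> ln L")
    case False
    then have "expansion m w < a" for w using expansion_le_ln_L[of m w] by linarith
    then have "{w \<in> space borel. expansion m w < a} = UNIV" by simp
    then show ?thesis by simp
  next
    case True
    have "expansion m w < a \<longleftrightarrow> (\<exists>i. w \<in> fst ` K i)" for w
    proof
      assume "expansion m w < a"
      then obtain w' where w': "\<pi> w' = \<pi> w" "w' \<noteq> w" "dist w w' < e m" "log_ratio w w' < a"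
        using True unfolding expansion_def e_def
        by (subst (asm) cInf_less_iff[OF _ bdd_below_log_ratios]) auto
      have d: "dist w w' > 0" "dist (g w) (g w') > 0" using w'(2) inj_g by (auto dest: injD)
      have "0 < min (dist w w') (min (e m - dist w w') (a - log_ratio w w'))" using d w' by simp
      then have "\<forall>\<^sub>F i in sequentially. e i < min (dist w w') (min (e m - dist w w') (a - log_ratio w w'))"
        by (rule order_tendstoD(2)[OF e0])
      then obtain i where i: "e i < dist w w'" "e i < e m - dist w w'" "e i < a - log_ratio w w'"
        unfolding eventually_sequentially by auto
      have "dist (g w) (g w') = exp (log_ratio w w') * dist w w'"
        using d by (simp add: log_ratio_def)
      also have "\<dots> \<le> exp (a - e i) * dist w w'" using i(3) by (intro mult_right_mono) auto
      finally have "(w, w') \<in> K i" using i w'(1) by (simp add: K_def)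
      then show "\<exists>i. w \<in> fst ` K i" by force
    next
      assume "\<exists>i. w \<in> fst ` K i"
      then obtain i w' where w': "(w, w') \<in> K i" by auto
      have d: "dist w w' > 0" using w' e[of i] by (auto simp: K_def)
      then have d2: "dist (g w) (g w') > 0" using inj_g by (auto dest: injD)
      have "log_ratio w w' \<le> ln (exp (a - e i))"
        unfolding log_ratio_def using w' d d2
        by (intro ln_mono) (auto simp: K_def pos_divide_le_eq)
      then have "log_ratio w w' < a" using e[of i] by simp
      moreover have "expansion m w \<le> log_ratio w w'"
        by (rule expansion_lower) (use w' d e[of i] in \<open>auto simp: K_def e_def[of m]\<close>)
      ultimately show "expansion m w < a" by simp
    qed
    then have eq: "{w \<in> space borel. expansion m w < a} = (\<Union>i. fst ` K i)" by auto
    have "compact (K i)" for i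
    proof -
      have cg: "continuous_on UNIV (\<lambda>z :: 'a \<times> 'a. g (fst z))" "continuous_on UNIV (\<lambda>z :: 'a \<times> 'a. g (snd z))"
        by (intro continuous_on_compose2[OF continuous_g] continuous_intros subset_UNIV)+
      have cp: "continuous_on UNIV (\<lambda>z :: 'a \<times> 'a. \<pi> (fst z))" "continuous_on UNIV (\<lambda>z :: 'a \<times> 'a. \<pi> (snd z))"
        by (intro continuous_on_compose2[OF continuous_proj] continuous_intros subset_UNIV)+
      have "closed (K i)"
        unfolding K_def
        by (intro closed_Collect_conj closed_Collect_eq closed_Collect_le continuous_intros cg cp)
      moreover have "compact (UNIV :: ('a \<times> 'a) set)"
        using compact_Times[OF compact_space compact_space] by simp
      ultimately show ?thesis using compact_Int_closed by fastforce
    qed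
    then have "closed (fst ` K i)" for i
      by (intro compact_imp_closed compact_continuous_image continuous_intros) auto
    then show ?thesis unfolding eq by (intro sets.countable_UN) auto
  qed
qed

text \<open>A point whose backward orbit accumulates expansion at rate \<open>c\<close> has a neighbourhood in its fibre,
  of size depending only on \<open>m\<close>, that the inverse map contracts exponentially: as long as the images
  stay close, the expansion applies to them, and the contraction so far keeps them close.\<close>

lemma backward_contraction:
  assumes sums: "\<And>n. real n * c \<le> birkhoff_sum (inv g) (\<lambda>w. expansion m (inv g w)) n u"
    and c: "0 \<le> c" and fib: "\<pi> u' = \<pi> u" and close: "L * dist u u' < 1 / real (Suc m)"
  shows "dist ((inv g ^^ j) u) ((inv g ^^ j) u') \<le> exp (- c * real j) * dist u u'"
proof -
  let ?h = "inv g"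
  define s where "s j = birkhoff_sum ?h (\<lambda>w. expansion m (?h w)) j u" for j
  have s_Suc: "s (Suc j) = s j + expansion m ((?h ^^ Suc j) u)" for j
    by (simp add: s_def birkhoff_sum_def)
  have s_nonneg: "0 \<le> s j" for j using sums[of j] c unfolding s_def
    by (meson mult_nonneg_nonneg of_nat_0_le_iff order_trans)
  have fib_j: "\<pi> ((?h ^^ j) u') = \<pi> ((?h ^^ j) u)" for j
  proof (induction j)
    case (Suc j)
    then show ?case using fibre_iff[of "?h ((?h ^^ j) u')" "?h ((?h ^^ j) u)"] by simp
  qed (simp add: fib)
  \<comment> \<open>Since \<open>s j\<close> is non-negative, the induction hypothesis also keeps the two orbits within the
    scale at which the expansion applies.\<close>
  have key: "exp (s j) * dist ((?h ^^ j) u) ((?h ^^ j) u') \<le> dist u u'" for j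
  proof (induction j)
    case (Suc j)
    let ?a = "(?h ^^ j) u" and ?b = "(?h ^^ j) u'"
    have "dist ?a ?b \<le> exp (s j) * dist ?a ?b"
      using s_nonneg[of j] mult_right_mono[of 1 "exp (s j)" "dist ?a ?b"] by simp
    then have "dist ?a ?b \<le> dist u u'" using Suc by linarith
    then have "L * dist ?a ?b \<le> L * dist u u'" using L_ge_1 by (intro mult_left_mono) auto
    then have "dist (?h ?a) (?h ?b) < 1 / real (Suc m)"
      using lipschitz_inv_g[of "?h ?a" "?h ?b"] close by simp
    then have "exp (expansion m (?h ?a)) * dist (?h ?a) (?h ?b) \<le> dist ?a ?b"
      using expansion_dist_le[of "?h ?b" "?h ?a" m] fib_j[of "Suc j"] by simp
    then have "exp (s j) * (exp (expansion m (?h ?a)) * dist (?h ?a) (?h ?b)) \<le> exp (s j) * dist ?a ?b"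
      by (intro mult_left_mono) auto
    also have "\<dots> \<le> dist u u'" by (rule Suc)
    finally show ?case by (simp add: s_Suc exp_add mult.assoc)
  qed (simp add: s_def)
  have "exp (real j * c) * dist ((?h ^^ j) u) ((?h ^^ j) u') \<le> exp (s j) * dist ((?h ^^ j) u) ((?h ^^ j) u')"
    using sums[of j] by (intro mult_right_mono) (auto simp: s_def)
  then have "exp (real j * c) * dist ((?h ^^ j) u) ((?h ^^ j) u') \<le> dist u u'"
    using key[of j] by linarith
  then have le: "exp (- c * real j) * (exp (real j * c) * dist ((?h ^^ j) u) ((?h ^^ j) u'))
      \<le> exp (- c * real j) * dist u u'"
    by (intro mult_left_mono) auto
  have "dist ((?h ^^ j) u) ((?h ^^ j) u') = exp (- c * real j + real j * c) * dist ((?h ^^ j) u) ((?h ^^ j) u')"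
    by simp
  also have "\<dots> = exp (- c * real j) * (exp (real j * c) * dist ((?h ^^ j) u) ((?h ^^ j) u'))"
    by (simp only: exp_add mult.assoc)
  also note le
  finally show ?thesis .
qed

text \<open>Suppose that points of a fibre visit \<open>H\<close> with lower frequency \<open>\<theta>\<close>. At a late time those of
  them that are in \<open>H\<close> are \<open>r\<close>-separated, since two that are closer would have started closer than
  the points are. So at most \<open>N\<close> of them are in \<open>H\<close> at once, and counting visits bounds their
  number by \<open>N / \<theta>\<close>.\<close>

lemma card_frequent_visitors:
  assumes contr: "\<And>u u' j. u \<in> H \<Longrightarrow> \<pi> u' = \<pi> u \<Longrightarrow> dist u u' < r \<Longrightarrow>
      dist ((inv g ^^ j) u) ((inv g ^^ j) u') \<le> exp (- c * real j) * dist u u'"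
    and c: "c > 0"
    and N: "\<And>X :: 'a set. \<forall>x\<in>X. \<forall>y\<in>X. x \<noteq> y \<longrightarrow> r \<le> dist x y \<Longrightarrow> card X \<le> N"
    and X: "finite X" "X \<subseteq> \<pi> -` {p}"
    and freq: "\<And>w. w \<in> X \<Longrightarrow> \<exists>K. \<forall>n. real n * \<theta> - K \<le> birkhoff_sum g (indicator H) n w"
  shows "real (card X) * \<theta> \<le> real N"
proof -
  have "\<exists>d>0. \<forall>x\<in>X. \<forall>y\<in>X. x \<noteq> y \<longrightarrow> d \<le> dist x y"
  proof -
    define D where "D = insert 1 ((\<lambda>(x, y). dist x y) ` {z \<in> X \<times> X. fst z \<noteq> snd z})"
    have "finite D" "D \<noteq> {}" "\<And>d. d \<in> D \<Longrightarrow> d > 0"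
      using X(1) by (auto simp: D_def)
    then have "Min D > 0" "\<And>d. d \<in> D \<Longrightarrow> Min D \<le> d" by auto
    moreover have "dist x y \<in> D" if "x \<in> X" "y \<in> X" "x \<noteq> y" for x y
      using that by (force simp: D_def)
    ultimately show ?thesis by blast
  qed
  then obtain d where d: "d > 0" "\<And>x y. x \<in> X \<Longrightarrow> y \<in> X \<Longrightarrow> x \<noteq> y \<Longrightarrow> d \<le> dist x y" by blast
  have "(\<lambda>j. exp (- c) ^ j * r) \<longlonglongrightarrow> 0 * r"
    using c by (intro tendsto_mult LIMSEQ_realpow_zero tendsto_const) auto
  then have "\<forall>\<^sub>F j in sequentially. exp (- c) ^ j * r < d"
    using d(1) by (intro order_tendstoD(2)) auto
  then obtain J where J: "\<And>j. j \<ge> J \<Longrightarrow> exp (- c) ^ j * r < d"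
    unfolding eventually_sequentially by blast
  define Y where "Y j = {w \<in> X. (g ^^ j) w \<in> H}" for j
  have fib: "\<pi> ((g ^^ j) w) = \<pi> ((g ^^ j) w')" if "w \<in> X" "w' \<in> X" for w w' j
    using that X(2) by (induction j) (auto simp: fibre_iff)
  have late: "card (Y j) \<le> N" if "j \<ge> J" for j
  proof -
    have "card (Y j) = card ((g ^^ j) ` Y j)"
      by (rule card_image[symmetric], rule inj_on_inverseI, rule inv_funpow_funpow)
    also have "\<dots> \<le> N"
    proof (rule N, intro ballI impI, rule ccontr)
      fix x y assume "x \<in> (g ^^ j) ` Y j" "y \<in> (g ^^ j) ` Y j" and xy: "x \<noteq> y" "\<not> r \<le> dist x y"
      then obtain w w' where w: "w \<in> X" "w' \<in> X" "x \<in> H" "x = (g ^^ j) w" "y = (g ^^ j) w'"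
        by (auto simp: Y_def)
      have "dist w w' \<le> exp (- c * real j) * dist x y"
        using contr[of x y j] fib[of w' w j] w xy(2) by (simp add: inv_funpow_funpow)
      also have "\<dots> \<le> exp (- c) ^ j * r"
        unfolding exp_of_nat2_mult using xy(2) by (intro mult_left_mono) auto
      also have "\<dots> < d" using J that by blast
      finally show False using d(2)[OF w(1,2)] w xy(1) by fastforce
    qed
    finally show ?thesis .
  qed
  have count: "(\<Sum>w\<in>X. birkhoff_sum g (indicator H) n w) \<le> real J * real (card X) + real n * real N" for n
  proof -
    have "(\<Sum>w\<in>X. birkhoff_sum g (indicator H) n w) = (\<Sum>j<n. \<Sum>w\<in>X. indicator H ((g ^^ j) w))"
      unfolding birkhoff_sum_def by (rule sum.swap)
    also have "\<dots> = (\<Sum>j<n. real (card (Y j)))"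
    proof (rule sum.cong[OF refl])
      fix j
      have "(\<Sum>w\<in>X. indicator H ((g ^^ j) w)) = (\<Sum>w\<in>X. if (g ^^ j) w \<in> H then 1 else (0::real))"
        by (rule sum.cong) (auto simp: indicator_def)
      also have "\<dots> = real (card (Y j))"
        using X(1) by (simp add: sum.If_cases Y_def Int_def)
      finally show "(\<Sum>w\<in>X. indicator H ((g ^^ j) w)) = real (card (Y j))" .
    qed
    also have "\<dots> \<le> (\<Sum>j<n. (if j < J then real (card X) else 0) + real N)"
    proof (rule sum_mono)
      fix j
      have "card (Y j) \<le> card X" using X(1) by (intro card_mono) (auto simp: Y_def)
      then show "real (card (Y j)) \<le> (if j < J then real (card X) else 0) + real N"
        using late[of j] by (auto simp: not_less)
    qed
    also have "\<dots> = real (card ({..<n} \<inter> {..<J})) * real (card X) + real n * real N"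
      by (simp add: sum.distrib sum.If_cases lessThan_def)
    also have "\<dots> \<le> real J * real (card X) + real n * real N"
      using card_mono[of "{..<J}" "{..<n} \<inter> {..<J}"] by (intro add_right_mono mult_right_mono) auto
    finally show ?thesis .
  qed
  have "\<forall>w\<in>X. \<exists>K. \<forall>n. real n * \<theta> - K \<le> birkhoff_sum g (indicator H) n w" using freq by blast
  then obtain K where K: "\<forall>w\<in>X. \<forall>n. real n * \<theta> - K w \<le> birkhoff_sum g (indicator H) n w"
    by (rule bchoice[THEN exE]) blast
  have linear: "real n * (real (card X) * \<theta> - real N) \<le> sum K X + real J * real (card X)" for n
  proof -
    have "(\<Sum>w\<in>X. real n * \<theta> - K w) \<le> (\<Sum>w\<in>X. birkhoff_sum g (indicator H) n w)"
      using K by (intro sum_mono) blast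
    then show ?thesis using count[of n] by (simp add: sum_subtractf algebra_simps)
  qed
  show ?thesis
  proof (rule ccontr)
    assume "\<not> ?thesis"
    then have "real (card X) * \<theta> - real N > 0" by simp
    then obtain n where "sum K X + real J * real (card X) < real n * (real (card X) * \<theta> - real N)"
      using reals_Archimedean3 by blast
    then show False using linear[of n] by linarith
  qed
qed

end

section \<open>Positive expansion forces finite fibres\<close>

locale ergodic_fibred_dynamics = fibred_dynamics g \<pi> L + prob_space M
  for g :: "'a::metric_space \<Rightarrow> 'a" and \<pi> :: "'a \<Rightarrow> 'b::t2_space" and L :: real
    and M :: "'a measure" +
  assumes sets_M: "sets M = sets borel"
    and ergodic_g: "ergodic M g"
begin

lemma space_M: "space M = UNIV"
  using sets_eq_imp_space_eq[OF sets_M] by simp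

lemma borel_measurable_M: "f \<in> measurable borel N \<Longrightarrow> f \<in> measurable M N"
  using measurable_cong_sets[OF sets_M refl] by blast

lemma preserves_g: "preserves_measure M g"
  using ergodic_g by (simp add: ergodic_def)

lemma measurable_g: "g \<in> measurable M M"
  using preserves_g by (simp add: preserves_measure_def)

lemma continuous_inv_g: "continuous_on UNIV (inv g)"
  unfolding continuous_on_iff
proof (intro ballI allI impI)
  fix x and e :: real assume "e > 0"
  have "dist (inv g y) (inv g x) < e" if "dist y x < e / L" for y
  proof -
    have "L * dist y x < e" using that L_ge_1 by (simp add: pos_less_divide_eq mult.commute)
    then show ?thesis using lipschitz_inv_g[of "inv g y" "inv g x"] by simp
  qed
  then show "\<exists>d>0. \<forall>y\<in>UNIV. dist y x < d \<longrightarrow> dist (inv g y) (inv g x) < e"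
    using \<open>e > 0\<close> L_ge_1 by (intro exI[of _ "e / L"]) auto
qed

lemma measurable_inv_g: "inv g \<in> measurable M M"
  using borel_measurable_continuous_onI[OF continuous_inv_g]
  by (simp add: measurable_cong_sets[OF sets_M sets_M])

lemma preserves_inv_g: "preserves_measure M (inv g)"
proof -
  have "distr M M (inv g) = distr (distr M M g) M (inv g)"
    using preserves_g by (simp add: preserves_measure_def)
  also have "\<dots> = distr M M (inv g \<circ> g)"
    by (rule distr_distr[OF measurable_inv_g measurable_g])
  also have "inv g \<circ> g = (\<lambda>x. x)" by auto
  finally show ?thesis using measurable_inv_g by (simp add: preserves_measure_def)
qed

lemma integrable_expansion: "integrable M (expansion m)"
  by (rule integrable_const_bound[where B = "ln L"])
     (auto simp: abs_expansion_le intro: borel_measurable_M measurable_expansion)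

lemma limit_expansion_bound: "\<bar>limit_expansion w\<bar> \<le> ln L"
proof -
  have "(\<lambda>m. \<bar>expansion m w\<bar>) \<longlonglongrightarrow> \<bar>limit_expansion w\<bar>"
    by (intro tendsto_rabs expansion_tendsto_limit)
  then show ?thesis by (rule LIMSEQ_le_const2) (use abs_expansion_le in auto)
qed

lemma integrable_limit_expansion: "integrable M limit_expansion"
proof (rule integrable_const_bound[where B = "ln L"])
  show "limit_expansion \<in> borel_measurable M"
    by (rule borel_measurable_LIMSEQ_metric[OF borel_measurable_M[OF measurable_expansion] expansion_tendsto_limit])
qed (use limit_expansion_bound in auto)

text \<open>Otherwise the limit expansion has integral at most \<open>0\<close>, and then, by the one-sided ergodic
  theorem, its sums cannot grow linearly.\<close>

theorem positive_expansion_integral: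
  assumes "rate > 0"
    and growth: "AE w in M. \<exists>a. (\<forall>n. a n \<le> birkhoff_sum g limit_expansion n w) \<and>
      (\<lambda>n. a n / real n) \<longlonglongrightarrow> rate"
  shows "\<exists>m. 0 < (\<integral>w. expansion m w \<partial>M)"
proof (rule ccontr)
  assume neg: "\<not> ?thesis"
  have "(\<lambda>m. \<integral>w. expansion m w \<partial>M) \<longlonglongrightarrow> (\<integral>w. limit_expansion w \<partial>M)"
    by (rule integral_dominated_convergence[where w = "\<lambda>_. ln L"])
       (auto simp: abs_expansion_le expansion_tendsto_limit
          intro: borel_measurable_integrable integrable_limit_expansion integrable_expansion)
  then have "(\<integral>w. limit_expansion w \<partial>M) \<le> 0"
    by (rule LIMSEQ_le_const2) (use neg in \<open>auto simp: not_less\<close>)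
  then have "0 < (\<integral>w. rate / 2 - limit_expansion w \<partial>M)"
    using assms(1) by (subst Bochner_Integration.integral_diff) (auto simp: integrable_limit_expansion prob_space)
  then have "AE w in M. \<exists>K. \<forall>n. - K \<le> birkhoff_sum g (\<lambda>w. rate / 2 - limit_expansion w) n w"
    by (intro birkhoff_sums_bounded_below ergodic_g Bochner_Integration.integrable_diff
        integrable_limit_expansion) auto
  then have "AE w in M. False"
    using growth
  proof eventually_elim
    case (elim w)
    obtain K where K: "\<And>n. - K \<le> birkhoff_sum g (\<lambda>w. rate / 2 - limit_expansion w) n w"
      using elim(1) by blast
    obtain a where a: "\<And>n. a n \<le> birkhoff_sum g limit_expansion n w" "(\<lambda>n. a n / real n) \<longlonglongrightarrow> rate"
      using elim(2) by blast
    have le: "a n \<le> K + real n * (rate / 2)" for n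
      using K[of n] a(1)[of n] by (simp add: birkhoff_sum_def sum_subtractf)
    have "(\<lambda>n. K / real n + rate / 2) \<longlonglongrightarrow> 0 + rate / 2"
      by (intro tendsto_add tendsto_const lim_const_over_n)
    moreover have "\<forall>\<^sub>F n in sequentially. a n / real n \<le> K / real n + rate / 2"
      using eventually_gt_at_top[of 0]
    proof eventually_elim
      case (elim n)
      then show ?case using divide_right_mono[OF le[of n], of "real n"] by (simp add: add_divide_distrib)
    qed
    ultimately have "rate \<le> 0 + rate / 2" by (rule tendsto_le[OF sequentially_bot _ a(2)])
    then show False using assms(1) by simp
  qed
  then show False by simp
qed

text \<open>The maximal inequality for the inverse map gives a set \<open>H\<close> of positive measure of points whose
  backward orbits accumulate expansion, and almost every point visits \<open>H\<close> with positive lower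
  frequency.\<close>

theorem full_measure_finite_fibres:
  assumes pos: "0 < (\<integral>w. expansion m w \<partial>M)"
  shows "\<exists>S\<in>sets M. (AE w in M. w \<in> S) \<and> (\<forall>p. finite (S \<inter> \<pi> -` {p}))"
proof -
  define c where "c = (\<integral>w. expansion m w \<partial>M) / 2"
  have c: "c > 0" using pos by (simp add: c_def)
  define f where "f w = expansion m (inv g w)" for w
  have int_f: "integrable M f"
    unfolding f_def by (rule integrable_preserved[OF preserves_inv_g integrable_expansion])
  then have [measurable]: "f \<in> borel_measurable M" by simp
  note [measurable] = measurable_g measurable_inv_g
  have "(\<integral>w. f w \<partial>M) = 2 * c"
    unfolding f_def c_def
    using integral_preserved[OF preserves_inv_g borel_measurable_integrable[OF integrable_expansion]] by simp
  then have "0 < (\<integral>w. f w - c \<partial>M)"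
    using int_f c by (simp add: prob_space)
  then have not_null: "\<not> (AE w in M. \<not> (\<forall>n. 0 \<le> birkhoff_sum (inv g) (\<lambda>w. f w - c) n w))"
    using int_f by (intro nonneg_birkhoff_sums_not_null[OF preserves_inv_g]) auto
  define H where "H = {w \<in> space M. \<forall>n. 0 \<le> birkhoff_sum (inv g) (\<lambda>w. f w - c) n w}"
  have meas_sum [measurable]: "birkhoff_sum (inv g) (\<lambda>w. f w - c) n \<in> borel_measurable M" for n
    by (rule measurable_birkhoff_sum[OF measurable_inv_g]) measurable
  have H [measurable]: "H \<in> sets M" unfolding H_def by measurable
  have "measure M H \<noteq> 0"
  proof
    assume "measure M H = 0"
    then have "H \<in> null_sets M" using H by (simp add: emeasure_eq_measure null_setsI)
    then have "AE w in M. w \<notin> H" by (rule AE_not_in)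
    then show False using not_null by (auto simp: H_def space_M)
  qed
  then have posH: "measure M H > 0" by (simp add: zero_less_measure_iff)
  \<comment> \<open>Any positive value strictly below the measure of \<open>H\<close> would do, to make the next integral positive.\<close>
  define \<theta> where "\<theta> = measure M H / 2"
  have \<theta>: "\<theta> > 0" using posH by (simp add: \<theta>_def)
  have int_H: "integrable M (indicator H :: 'a \<Rightarrow> real)"
    using H by (simp add: integrable_indicator_iff emeasure_eq_measure)
  have "0 < (\<integral>w. indicator H w - \<theta> \<partial>M)"
    using int_H posH H by (simp add: prob_space \<theta>_def)
  then have bb: "AE w in M. \<exists>K. \<forall>n. - K \<le> birkhoff_sum g (\<lambda>w. indicator H w - \<theta>) n w"
    using int_H by (intro birkhoff_sums_bounded_below ergodic_g) auto
  have [measurable]: "birkhoff_sum g (\<lambda>w. indicator H w - \<theta>) n \<in> borel_measurable M" for n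
    by (rule measurable_birkhoff_sum[OF measurable_g]) measurable
  define S where "S = {w \<in> space M. \<exists>K::nat. \<forall>n. - real K \<le> birkhoff_sum g (\<lambda>w. indicator H w - \<theta>) n w}"
  have "S \<in> sets M" unfolding S_def by measurable
  moreover have "AE w in M. w \<in> S"
    using bb
  proof eventually_elim
    case (elim w)
    then obtain K where K: "\<And>n. - K \<le> birkhoff_sum g (\<lambda>w. indicator H w - \<theta>) n w" by blast
    obtain k :: nat where "K \<le> real k" using real_arch_simple by blast
    then have "- real k \<le> birkhoff_sum g (\<lambda>w. indicator H w - \<theta>) n w" for n using K[of n] by linarith
    then show ?case by (auto simp: S_def space_M)
  qed
  moreover have "finite (S \<inter> \<pi> -` {p})" for p
  proof -
    \<comment> \<open>The inverse map stretches distances at most by \<open>L\<close>, so that after one backward step from points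
      closer than \<open>r\<close> the expansion at scale \<open>1 / (m + 1)\<close> applies.\<close>
    define r where "r = 1 / (L * real (Suc m))"
    have r: "r > 0" using L_ge_1 by (simp add: r_def)
    obtain N where N: "\<And>X :: 'a set. \<forall>x\<in>X. \<forall>y\<in>X. x \<noteq> y \<longrightarrow> r \<le> dist x y \<Longrightarrow> card X \<le> N"
      using separated_card_bound[OF compact_space r] by blast
    have contr: "dist ((inv g ^^ j) u) ((inv g ^^ j) u') \<le> exp (- c * real j) * dist u u'"
      if "u \<in> H" "\<pi> u' = \<pi> u" "dist u u' < r" for u u' j
    proof (rule backward_contraction[where m = m])
      show "real n * c \<le> birkhoff_sum (inv g) (\<lambda>w. expansion m (inv g w)) n u" for n
        using that(1) by (simp add: H_def birkhoff_sum_diff_const f_def)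
      show "L * dist u u' < 1 / real (Suc m)"
        using that(3) L_ge_1 unfolding r_def by (simp add: field_simps del: of_nat_Suc)
    qed (use that c in auto)
    have bound: "card X \<le> nat \<lfloor>real N / \<theta>\<rfloor>" if X: "X \<subseteq> S \<inter> \<pi> -` {p}" "finite X" for X
    proof -
      have "real (card X) * \<theta> \<le> real N"
      proof (rule card_frequent_visitors[OF contr c N X(2)])
        show "\<exists>K. \<forall>n. real n * \<theta> - K \<le> birkhoff_sum g (indicator H) n w" if "w \<in> X" for w
        proof -
          obtain K :: nat where "\<And>n. - real K \<le> birkhoff_sum g (\<lambda>w. indicator H w - \<theta>) n w"
            using subsetD[OF X(1) \<open>w \<in> X\<close>] unfolding S_def by blast
          then have "real n * \<theta> - real K \<le> birkhoff_sum g (indicator H) n w" for n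
            by (simp add: birkhoff_sum_diff_const algebra_simps)
          then show ?thesis by blast
        qed
      qed (use X in auto)
      then have "real (card X) \<le> real N / \<theta>" using \<theta> by (simp add: pos_le_divide_eq)
      then show ?thesis by (simp add: le_nat_floor)
    qed
    show ?thesis
    proof (rule ccontr)
      assume "infinite (S \<inter> \<pi> -` {p})"
      then obtain X where "X \<subseteq> S \<inter> \<pi> -` {p}" "finite X" "card X = Suc (nat \<lfloor>real N / \<theta>\<rfloor>)"
        by (meson infinite_arbitrarily_large)
      then show False using bound[of X] by simp
    qed
  qed
  ultimately show ?thesis by blast
qed

end

text \<open>The limit expansion is the lower limit of the logarithmic ratios, capped at \<open>ln L\<close>. The cap is
  harmless when the point is not isolated in its fibre, because the ratios themselves respect it.\<close>

lemma (in fibred_dynamics) limit_expansion_ge: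
  assumes lim: "(log_ratio w \<longlongrightarrow> \<rho>) (at w within \<pi> -` {\<pi> w})"
    and nontrivial: "at w within \<pi> -` {\<pi> w} \<noteq> bot"
  shows "\<rho> \<le> limit_expansion w"
proof (rule field_le_epsilon)
  fix e :: real assume "e > 0"
  have "\<forall>\<^sub>F w' in at w within \<pi> -` {\<pi> w}. log_ratio w w' \<le> ln L"
    unfolding eventually_at_filter using log_ratio_bounds(1) by (intro always_eventually) auto
  then have \<rho>: "\<rho> \<le> ln L" by (rule tendsto_upperbound[OF lim _ nontrivial])
  have "\<forall>\<^sub>F w' in at w within \<pi> -` {\<pi> w}. \<rho> - e < log_ratio w w'"
    using \<open>e > 0\<close> by (intro order_tendstoD(1)[OF lim]) auto
  then obtain d where d: "d > 0"
    "\<And>w'. \<pi> w' = \<pi> w \<Longrightarrow> w' \<noteq> w \<Longrightarrow> dist w' w < d \<Longrightarrow> \<rho> - e < log_ratio w w'"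
    unfolding eventually_at by auto
  obtain m where m: "1 / real (Suc m) < d"
    using reals_Archimedean[OF d(1)] by (auto simp: inverse_eq_divide)
  have "\<rho> - e \<le> expansion m w"
  proof (rule expansion_greatest)
    fix w' assume "\<pi> w' = \<pi> w" "w' \<noteq> w" "dist w w' < 1 / real (Suc m)"
    then show "\<rho> - e \<le> log_ratio w w'"
      using d(2)[of w'] m by (simp add: dist_commute)
  qed (use \<rho> \<open>e > 0\<close> in simp)
  then show "\<rho> \<le> limit_expansion w + e" using expansion_le_limit[of m w] by linarith
qed

section \<open>Counting points in fibres\<close>

definition sigma_compact :: "'a::topological_space set \<Rightarrow> bool" where
  "sigma_compact S \<longleftrightarrow> (\<exists>K :: nat \<Rightarrow> 'a set. (\<forall>n. compact (K n)) \<and> S = (\<Union>n. K n))"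

lemma compact_imp_sigma_compact: "compact K \<Longrightarrow> sigma_compact K"
  unfolding sigma_compact_def by (rule exI[of _ "\<lambda>_. K"]) auto

lemma sigma_compact_UN:
  assumes "\<And>i j. compact (K i j)"
  shows "sigma_compact (\<Union>i j :: nat. K (i :: nat) j)"
proof -
  have "(\<Union>i j. K i j) = (\<Union>n. K (fst (prod_decode n)) (snd (prod_decode n)))"
  proof (intro equalityI subsetI)
    fix x assume "x \<in> (\<Union>i j. K i j)"
    then obtain i j where "x \<in> K i j" by blast
    then have "x \<in> K (fst (prod_decode (prod_encode (i, j)))) (snd (prod_decode (prod_encode (i, j))))"
      by simp
    then show "x \<in> (\<Union>n. K (fst (prod_decode n)) (snd (prod_decode n)))" by blast
  qed blast
  then show ?thesis
    unfolding sigma_compact_def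
    by (intro exI[of _ "\<lambda>n. K (fst (prod_decode n)) (snd (prod_decode n))"]) (simp add: assms)
qed

lemma sigma_compact_Int:
  fixes S T :: "'a::t2_space set"
  assumes "sigma_compact S" "sigma_compact T"
  shows "sigma_compact (S \<inter> T)"
proof -
  obtain K where K: "\<And>n. compact (K n)" "S = (\<Union>n::nat. K n)"
    using assms(1) unfolding sigma_compact_def by blast
  obtain J where J: "\<And>n. compact (J n)" "T = (\<Union>n::nat. J n)"
    using assms(2) unfolding sigma_compact_def by blast
  have "compact (K i \<inter> J j)" for i j
    using K(1) J(1) compact_imp_closed by (blast intro: compact_Int_closed)
  then have "sigma_compact (\<Union>i j. K i \<inter> J j)" by (rule sigma_compact_UN)
  moreover have "S \<inter> T = (\<Union>i j. K i \<inter> J j)" using K(2) J(2) by blast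
  ultimately show ?thesis by simp
qed

lemma fsigma_imp_sigma_compact:
  fixes C :: "'a::euclidean_space set"
  assumes "fsigma C"
  shows "sigma_compact C"
  using assms
proof cases
  case (1 F)
  have "compact (F i \<inter> cball 0 (real j))" for i j
    using 1(2) by (intro closed_Int_compact) auto
  then have "sigma_compact (\<Union>i j. F i \<inter> cball 0 (real j))" by (rule sigma_compact_UN)
  moreover have "x \<in> (\<Union>j. cball 0 (real j))" for x :: 'a
    using real_arch_simple[of "norm x"] by auto
  then have "C = (\<Union>i j. F i \<inter> cball 0 (real j))" unfolding 1(1) by auto
  ultimately show ?thesis by simp
qed

lemma sigma_compact_image:
  assumes "sigma_compact S" "continuous_on UNIV f"
  shows "sigma_compact (f ` S)"
proof -
  obtain K where K: "\<And>n. compact (K n)" "S = (\<Union>n::nat. K n)"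
    using assms(1) unfolding sigma_compact_def by blast
  have "compact (f ` K n)" for n
    using K(1) continuous_on_subset[OF assms(2)] by (intro compact_continuous_image) auto
  moreover have "f ` S = (\<Union>n. f ` K n)" using K(2) by auto
  ultimately show ?thesis unfolding sigma_compact_def by (intro exI[of _ "\<lambda>n. f ` K n"]) auto
qed

lemma sigma_compact_borel:
  fixes S :: "'a::t2_space set"
  assumes "sigma_compact S"
  shows "S \<in> sets borel"
proof -
  obtain K where K: "\<And>n. compact (K n)" "S = (\<Union>n::nat. K n)"
    using assms unfolding sigma_compact_def by blast
  then show ?thesis by (auto intro: borel_compact)
qed

lemma sigma_compact_ball:
  assumes "compact (UNIV :: 'a::metric_space set)"
  shows "sigma_compact (ball (c :: 'a) r)"
proof -
  have "compact (cball c (r - 1 / real (Suc n)))" for n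
    using compact_Int_closed[OF assms closed_cball] by simp
  moreover have "ball c r = (\<Union>n. cball c (r - 1 / real (Suc n)))"
  proof (intro equalityI subsetI)
    fix x assume "x \<in> ball c r"
    then obtain n where "1 / real (Suc n) < r - dist c x"
      using reals_Archimedean[of "r - dist c x"] by (auto simp: inverse_eq_divide)
    then have "x \<in> cball c (r - 1 / real (Suc n))" by simp
    then show "x \<in> (\<Union>n. cball c (r - 1 / real (Suc n)))" by blast
  next
    fix x assume "x \<in> (\<Union>n. cball c (r - 1 / real (Suc n)))"
    then obtain n where "dist c x \<le> r - 1 / real (Suc n)" by auto
    moreover have "1 / real (Suc n) > 0" by simp
    ultimately have "dist c x < r" by linarith
    then show "x \<in> ball c r" by simp
  qed
  ultimately show ?thesis unfolding sigma_compact_def by (intro exI conjI allI)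
qed

text \<open>Recording which balls of a finite cover contain a point separates, for fine covers, any two
  given points.\<close>

lemma separating_cells:
  assumes comp: "compact (UNIV :: 'a::metric_space set)"
  obtains cell :: "nat \<Rightarrow> 'a::metric_space \<Rightarrow> 'a set" where
    "\<And>n. finite (range (cell n))"
    "\<And>n A. sigma_compact {x. cell n x = A}"
    "\<And>x y. x \<noteq> y \<Longrightarrow> \<forall>\<^sub>F n in sequentially. cell n x \<noteq> cell n y"
proof -
  define r where "r n = 1 / real (Suc n)" for n
  have r: "r n > 0" for n by (simp add: r_def)
  have "\<forall>n. \<exists>C :: 'a set. finite C \<and> UNIV \<subseteq> (\<Union>x\<in>C. ball x (r n))"
    using compact_imp_seq_compact[OF comp, THEN seq_compact_imp_totally_bounded] r by auto
  then obtain C :: "nat \<Rightarrow> 'a set" where C: "\<forall>n. finite (C n) \<and> UNIV \<subseteq> (\<Union>x\<in>C n. ball x (r n))"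
    by (rule choice[THEN exE]) blast
  define cell where "cell n x = {c \<in> C n. x \<in> ball c (r n)}" for n x
  show thesis
  proof (rule that[of cell])
    show "finite (range (cell n))" for n
      by (rule finite_subset[of _ "Pow (C n)"]) (use C in \<open>auto simp: cell_def\<close>)
    show "sigma_compact {x. cell n x = A}" for n A
    proof (cases "A \<subseteq> C n")
      case False
      then have "{x. cell n x = A} = {}" by (auto simp: cell_def)
      then show ?thesis by (simp add: compact_imp_sigma_compact)
    next
      case True
      have sc: "sigma_compact {x. \<forall>c\<in>B. x \<in> ball c (r n) \<longleftrightarrow> c \<in> A}" if "finite B" for B
        using that
      proof (induction B)
        case empty
        then show ?case using compact_imp_sigma_compact[OF comp] by simp
      next
        case (insert b B)
        have "sigma_compact (if b \<in> A then ball b (r n) else - ball b (r n))"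
          using sigma_compact_ball[OF comp] compact_Int_closed[OF comp, of "- ball b (r n)"]
          by (auto intro: compact_imp_sigma_compact)
        moreover have "{x. \<forall>c\<in>insert b B. x \<in> ball c (r n) \<longleftrightarrow> c \<in> A}
            = (if b \<in> A then ball b (r n) else - ball b (r n)) \<inter> {x. \<forall>c\<in>B. x \<in> ball c (r n) \<longleftrightarrow> c \<in> A}"
          by auto
        ultimately show ?case using sigma_compact_Int[OF _ insert.IH] by simp
      qed
      have "{x. cell n x = A} = {x. \<forall>c\<in>C n. x \<in> ball c (r n) \<longleftrightarrow> c \<in> A}"
        using True by (auto simp: cell_def)
      then show ?thesis using sc[of "C n"] C by simp
    qed
    show "\<forall>\<^sub>F n in sequentially. cell n x \<noteq> cell n y" if "x \<noteq> y" for x y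
    proof -
      have "r \<longlonglongrightarrow> 0" unfolding r_def using LIMSEQ_inverse_real_of_nat by (simp add: inverse_eq_divide)
      then have "\<forall>\<^sub>F n in sequentially. r n < dist x y / 2"
        using that by (intro order_tendstoD(2)) auto
      then show ?thesis
      proof eventually_elim
        case (elim n)
        obtain c where c: "c \<in> C n" "dist c x < r n" using C by (force simp: subset_eq)
        have "dist x y \<le> dist c x + dist c y" by (rule dist_triangle3)
        then have "\<not> dist c y < r n" using elim c by linarith
        then show ?case using c by (auto simp: cell_def)
      qed
    qed
  qed
qed

lemma eventually_inj_on_cells:
  assumes "finite X" and sep: "\<And>x y. x \<noteq> y \<Longrightarrow> \<forall>\<^sub>F n in sequentially. cell n x \<noteq> cell n y"
  shows "\<forall>\<^sub>F n in sequentially. inj_on (cell n) X"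
proof -
  have "\<forall>\<^sub>F n in sequentially. \<forall>x\<in>X. \<forall>y\<in>X. x \<noteq> y \<longrightarrow> cell n x \<noteq> cell n y"
  proof (intro eventually_ball_finite[OF assms(1)] ballI)
    fix x y
    show "\<forall>\<^sub>F n in sequentially. x \<noteq> y \<longrightarrow> cell n x \<noteq> cell n y"
      using sep[of x y] by (cases "x = y") auto
  qed
  then show ?thesis by eventually_elim (auto simp: inj_on_def)
qed

text \<open>Projections of Borel sets need not be Borel, whereas projections of \<open>\<sigma>\<close>-compact sets are
  \<open>\<sigma>\<close>-compact. This is why points are counted in \<open>\<sigma>\<close>-compact sets: the number of points in a finite
  fibre is the limit of the numbers of cells that the fibre occupies.\<close>

lemma measurable_fibre_card:
  fixes \<pi> :: "'a::metric_space \<Rightarrow> 'b::t2_space"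
  assumes comp: "compact (UNIV :: 'a set)" and cont: "continuous_on UNIV \<pi>"
    and S: "sigma_compact S" and fin: "\<And>p. finite (S \<inter> \<pi> -` {p})"
  shows "(\<lambda>w. real (card (S \<inter> \<pi> -` {\<pi> w}))) \<in> borel_measurable borel"
proof -
  obtain cell :: "nat \<Rightarrow> 'a \<Rightarrow> 'a set" where cell: "\<And>n. finite (range (cell n))"
    "\<And>n A. sigma_compact {x. cell n x = A}"
    "\<And>x y. x \<noteq> y \<Longrightarrow> \<forall>\<^sub>F n in sequentially. cell n x \<noteq> cell n y"
    using separating_cells[OF comp] by blast
  define hit where "hit n A = \<pi> -` \<pi> ` (S \<inter> {x. cell n x = A})" for n A
  define count where "count n w = (\<Sum>A\<in>range (cell n). indicator (hit n A) w :: real)" for n w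
  have "hit n A \<in> sets borel" for n A
  proof -
    have "\<pi> ` (S \<inter> {x. cell n x = A}) \<in> sets borel"
      by (intro sigma_compact_borel sigma_compact_image[OF _ cont] sigma_compact_Int S cell(2))
    then show ?thesis unfolding hit_def
      using measurable_sets[OF borel_measurable_continuous_onI[OF cont]] by fastforce
  qed
  then have meas: "count n \<in> borel_measurable borel" for n
    unfolding count_def[abs_def] by (intro borel_measurable_sum borel_measurable_indicator)
  have "(\<lambda>n. count n w) \<longlonglongrightarrow> real (card (S \<inter> \<pi> -` {\<pi> w}))" for w
  proof (rule tendsto_eventually)
    let ?X = "S \<inter> \<pi> -` {\<pi> w}"
    have "\<forall>\<^sub>F n in sequentially. inj_on (cell n) ?X"
      by (rule eventually_inj_on_cells[OF fin]) (rule cell(3))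
    then show "\<forall>\<^sub>F n in sequentially. count n w = real (card ?X)"
    proof eventually_elim
      case (elim n)
      have "w \<in> hit n A \<longleftrightarrow> A \<in> cell n ` ?X" for A
      proof
        assume "A \<in> cell n ` ?X"
        then obtain x where "x \<in> S \<inter> {x. cell n x = A}" "\<pi> w = \<pi> x" by auto
        then show "w \<in> hit n A" unfolding hit_def by blast
      qed (auto simp: hit_def)
      then have "count n w = (\<Sum>A\<in>range (cell n). if A \<in> cell n ` ?X then 1 else 0)"
        unfolding count_def by (intro sum.cong) (auto simp: indicator_def)
      also have "\<dots> = real (card (range (cell n) \<inter> cell n ` ?X))"
        using cell(1) by (simp add: sum.If_cases Int_def)
      also have "range (cell n) \<inter> cell n ` ?X = cell n ` ?X" by blast
      finally show ?case using card_image[OF elim] by simp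
    qed
  qed
  then show ?thesis by (rule borel_measurable_LIMSEQ_metric[OF meas])
qed

lemma eventually_decreasing_Int_eq:
  assumes "finite (f 0 \<inter> F)" "\<And>n. f (Suc n) \<subseteq> f n"
  shows "\<forall>\<^sub>F n in sequentially. f n \<inter> F = (\<Inter>n. f n) \<inter> F"
proof -
  have anti: "f n \<subseteq> f m" if "m \<le> n" for m n
    using lift_Suc_antimono_le[of f, OF assms(2) that] .
  have "\<forall>\<^sub>F n in sequentially. \<forall>x\<in>f 0 \<inter> F. x \<in> f n \<longrightarrow> x \<in> (\<Inter>n. f n)"
  proof (intro eventually_ball_finite[OF assms(1)] ballI)
    fix x
    show "\<forall>\<^sub>F n in sequentially. x \<in> f n \<longrightarrow> x \<in> (\<Inter>n. f n)"
    proof (cases "x \<in> (\<Inter>n. f n)")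
      case False
      then obtain m where "x \<notin> f m" by blast
      then have "x \<notin> f n" if "n \<ge> m" for n using anti[OF that] by blast
      then show ?thesis unfolding eventually_sequentially by blast
    qed simp
  qed
  then show ?thesis
  proof eventually_elim
    case (elim n)
    then show ?case using anti[of 0 n] by blast
  qed
qed

text \<open>The full-measure set is replaced by the intersection \<open>T\<close> of a decreasing sequence of
  \<open>\<sigma>\<close>-compact sets of full measure, each contained in the image and the preimage of its predecessor.
  Then \<open>T\<close> is invariant, so its number of points in the fibre through a point is an invariant
  function; it is measurable as a limit, because finite fibres stabilise along the sequence.\<close>

theorem (in ergodic_fibred_dynamics) constant_fibre_card:
  assumes S0: "S0 \<in> sets M" "AE w in M. w \<in> S0" "\<And>p. finite (S0 \<inter> \<pi> -` {p})"
    and inner: "\<And>E. E \<in> sets M \<Longrightarrow> AE w in M. w \<in> E \<Longrightarrow>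
      \<exists>S\<subseteq>E. sigma_compact S \<and> (AE w in M. w \<in> S)"
  shows "\<exists>T\<in>sets M. \<exists>k\<ge>1. (AE w in M. w \<in> T) \<and> (AE w in M. card (T \<inter> \<pi> -` {\<pi> w}) = k)"
proof -
  define good where "good S \<longleftrightarrow> sigma_compact S \<and> (AE w in M. w \<in> S) \<and> S \<subseteq> S0" for S
  have sc_M: "S \<in> sets M" if "sigma_compact S" for S
    using sigma_compact_borel[OF that] sets_M by simp
  have AE_comp: "AE w in M. T w \<in> S"
    if "preserves_measure M T" "S \<in> sets M" "AE w in M. w \<in> S" for T S
  proof -
    have "distr M M T = M" using that(1) by (simp add: preserves_measure_def)
    then have "AE w in distr M M T. w \<in> S" using that(3) by metis
    then show ?thesis using that(1,2)
      by (subst (asm) AE_distr_iff) (auto simp: preserves_measure_def space_M)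
  qed
  have "\<exists>S. good S"
    using inner[OF S0(1,2)] by (auto simp: good_def)
  moreover have "\<exists>S'. good S' \<and> S' \<subseteq> S \<inter> g -` S \<inter> inv g -` S" if "good S" for S
  proof -
    have S: "S \<in> sets M" "AE w in M. w \<in> S" using that sc_M by (auto simp: good_def)
    have "g -` S \<in> sets M" "inv g -` S \<in> sets M"
      using measurable_sets[OF measurable_g S(1)] measurable_sets[OF measurable_inv_g S(1)]
      by (simp_all add: space_M)
    then have "S \<inter> g -` S \<inter> inv g -` S \<in> sets M" using S(1) by blast
    moreover have "AE w in M. w \<in> S \<inter> g -` S \<inter> inv g -` S"
      using S(2) AE_comp[OF preserves_g S] AE_comp[OF preserves_inv_g S] by eventually_elim simp
    ultimately obtain S' where "S' \<subseteq> S \<inter> g -` S \<inter> inv g -` S" "sigma_compact S'" "AE w in M. w \<in> S'"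
      using inner by blast
    then show ?thesis using that unfolding good_def by (intro exI[of _ S']) blast
  qed
  ultimately obtain f where f: "\<And>n. good (f n)" "\<And>n. f (Suc n) \<subseteq> f n \<inter> g -` f n \<inter> inv g -` f n"
    using dependent_nat_choice[of "\<lambda>_. good" "\<lambda>_ S S'. S' \<subseteq> S \<inter> g -` S \<inter> inv g -` S"] by metis
  define T where "T = (\<Inter>n. f n)"
  have fM: "f n \<in> sets M" for n using f(1) sc_M by (auto simp: good_def)
  then have T_M: "T \<in> sets M" unfolding T_def by blast
  have "AE w in M. \<forall>n. w \<in> f n" using f(1) by (auto simp: AE_all_countable good_def)
  then have AE_T: "AE w in M. w \<in> T" by eventually_elim (simp add: T_def)
  have fin: "finite (f n \<inter> \<pi> -` {p})" for n p
    by (rule finite_subset[OF _ S0(3)[of p]]) (use f(1) in \<open>auto simp: good_def\<close>)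
  have T_iff: "g w \<in> T \<longleftrightarrow> w \<in> T" for w
  proof
    assume "g w \<in> T"
    then have "g w \<in> f (Suc n)" for n by (simp add: T_def)
    then have "inv g (g w) \<in> f n" for n using f(2)[of n] by blast
    then show "w \<in> T" by (simp add: T_def)
  next
    assume "w \<in> T"
    then have "w \<in> f (Suc n)" for n by (simp add: T_def)
    then have "g w \<in> f n" for n using f(2)[of n] by blast
    then show "g w \<in> T" by (simp add: T_def)
  qed
  define N where "N w = card (T \<inter> \<pi> -` {\<pi> w})" for w
  have N_inv: "N (g w) = N w" for w
  proof -
    have "T \<inter> \<pi> -` {\<pi> (g w)} = g ` (T \<inter> \<pi> -` {\<pi> w})"
    proof (intro equalityI subsetI)
      fix x assume x: "x \<in> T \<inter> \<pi> -` {\<pi> (g w)}"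
      then have "inv g x \<in> T \<inter> \<pi> -` {\<pi> w}"
        using T_iff[of "inv g x"] fibre_iff[of "inv g x" w] by simp
      then show "x \<in> g ` (T \<inter> \<pi> -` {\<pi> w})" using g_inv_g[of x] by (metis imageI)
    qed (auto simp: T_iff fibre_iff)
    then show ?thesis unfolding N_def using card_image[OF inj_on_subset[OF inj_g subset_UNIV]] by simp
  qed
  have N_meas: "(\<lambda>w. real (N w)) \<in> borel_measurable M"
  proof (rule borel_measurable_LIMSEQ_metric)
    show "(\<lambda>w. real (card (f n \<inter> \<pi> -` {\<pi> w}))) \<in> borel_measurable M" for n
      by (intro borel_measurable_M measurable_fibre_card[OF compact_space continuous_proj _ fin])
         (use f(1) in \<open>auto simp: good_def\<close>)
    show "(\<lambda>n. real (card (f n \<inter> \<pi> -` {\<pi> w}))) \<longlonglongrightarrow> real (N w)" for w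
    proof (rule tendsto_eventually)
      show "\<forall>\<^sub>F n in sequentially. real (card (f n \<inter> \<pi> -` {\<pi> w})) = real (N w)"
        using eventually_decreasing_Int_eq[of f "\<pi> -` {\<pi> w}", OF fin] f(2)
        unfolding N_def T_def by (auto elim!: eventually_mono)
    qed
  qed
  have "\<exists>k. AE w in M. N w = k"
  proof (rule ccontr)
    assume neg: "\<nexists>k. AE w in M. N w = k"
    have "AE w in M. N w \<noteq> k" for k
    proof -
      define A where "A = {w \<in> space M. real (N w) = real k}"
      have "A \<in> sets M" unfolding A_def using N_meas by measurable
      moreover have "g -` A \<inter> space M = A" by (auto simp: A_def N_inv space_M)
      ultimately have "(AE w in M. w \<notin> A) \<or> (AE w in M. w \<in> A)"
        by (rule ergodic_zero_one[OF ergodic_g])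
      then show ?thesis using neg by (auto simp: A_def space_M)
    qed
    then have "AE w in M. \<forall>k. N w \<noteq> k" unfolding AE_all_countable by blast
    then have "AE w in M. False" by eventually_elim blast
    then show False by simp
  qed
  then obtain k where k: "AE w in M. N w = k" by blast
  have "k \<ge> 1"
  proof (rule ccontr)
    assume "\<not> k \<ge> 1"
    then have "k = 0" by simp
    then have "AE w in M. N w = 0" using k by blast
    then have "AE w in M. False"
      using AE_T
    proof eventually_elim
      case (elim w)
      have "finite (T \<inter> \<pi> -` {\<pi> w})"
        by (rule finite_subset[OF _ fin[of 0]]) (auto simp: T_def)
      then show ?case using elim by (auto simp: N_def)
    qed
    then show False by simp
  qed
  then show ?thesis using T_M AE_T k unfolding N_def by blast
qed

section \<open>Haar measure\<close>

lemma sets_haar: "sets (haar :: 'n::finite torus measure) = sets borel"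
  by (simp add: haar_def)

abbreviation unit_cube :: "(real^'n) set" where
  "unit_cube \<equiv> {x. \<forall>i. 0 \<le> x $ i \<and> x $ i < 1}"

lemma unit_cube_borel: "(unit_cube :: (real^'n::finite) set) \<in> sets borel"
proof -
  have "unit_cube = (\<Inter>i. {x :: real^'n. 0 \<le> x $ i} \<inter> {x. x $ i < 1})" by auto
  moreover have "{x :: real^'n. 0 \<le> x $ i} \<in> sets borel" "{x :: real^'n. x $ i < 1} \<in> sets borel" for i
    by (auto intro!: borel_closed borel_open closed_Collect_le open_Collect_less continuous_intros)
  ultimately show ?thesis by (simp add: sets.finite_INT)
qed

lemma to_torus_measurable: "to_torus \<in> measurable (restrict_space lborel unit_cube) borel"
  by (intro measurable_restrict_space1) (simp add: borel_measurable_continuous_onI[OF continuous_to_torus])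

lemma emeasure_unit_cube: "emeasure lborel (unit_cube :: (real^'n::finite) set) = 1"
proof (rule antisym)
  have one: "(1 :: real^'n) \<bullet> b = 1" if "b \<in> Basis" for b
    using that by (auto simp: Basis_vec_def inner_axis)
  have "emeasure lborel (unit_cube :: (real^'n) set) \<le> emeasure lborel (cbox 0 (1 :: real^'n))"
    by (rule emeasure_mono) (auto simp: mem_box_cart less_imp_le)
  also have "\<dots> = 1" by (subst emeasure_lborel_cbox) (auto simp: one)
  finally show "emeasure lborel (unit_cube :: (real^'n) set) \<le> 1" .
  have "1 = emeasure lborel (box 0 (1 :: real^'n))" by (subst emeasure_lborel_box) (auto simp: one)
  also have "\<dots> \<le> emeasure lborel (unit_cube :: (real^'n) set)"
    by (rule emeasure_mono) (use unit_cube_borel in \<open>auto simp: mem_box_cart less_imp_le\<close>)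
  finally show "1 \<le> emeasure lborel (unit_cube :: (real^'n) set)" .
qed

lemma prob_space_haar: "prob_space (haar :: 'n::finite torus measure)"
  unfolding haar_def
proof (rule prob_space.prob_space_distr[OF _ to_torus_measurable])
  show "prob_space (restrict_space lborel (unit_cube :: (real^'n) set))"
    by (rule prob_spaceI)
       (use unit_cube_borel emeasure_unit_cube in \<open>simp add: emeasure_restrict_space space_restrict_space\<close>)
qed

lemma AE_haar_iff:
  assumes "{w. P w} \<in> sets borel"
  shows "(AE w in haar. P w) \<longleftrightarrow> (AE x in lborel. x \<in> unit_cube \<longrightarrow> P (to_torus x))"
  unfolding haar_def
  by (subst AE_distr_iff[OF to_torus_measurable]) (use assms unit_cube_borel in \<open>auto simp: AE_restrict_space_iff\<close>)

text \<open>Inner regularity, transported from Lebesgue measure: the part of the preimage of \<open>E\<close> in the unit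
  cube is a countable union of closed sets up to a null set, and images of compact sets are compact.\<close>

lemma haar_inner_sigma_compact:
  fixes E :: "'n::finite torus set"
  assumes E: "E \<in> sets haar" "AE w in haar. w \<in> E"
  shows "\<exists>S\<subseteq>E. sigma_compact S \<and> (AE w in haar. w \<in> S)"
proof -
  define B where "B = unit_cube \<inter> to_torus -` E"
  have E': "E \<in> sets borel" using E(1) by (simp add: sets_haar)
  have "to_torus -` E \<in> sets borel"
    using measurable_sets[OF borel_measurable_continuous_onI[OF continuous_to_torus] E'] by simp
  then have "B \<in> sets borel" unfolding B_def using unit_cube_borel by (rule sets.Int[rotated])
  then have "B \<in> sets lebesgue" by simp
  then obtain C N where C: "fsigma C" and N: "N \<in> null_sets lebesgue" and B: "C \<union> N = B"
    by (rule lebesgue_set_almost_fsigma)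
  have "sigma_compact C" using C by (rule fsigma_imp_sigma_compact)
  then have sc: "sigma_compact (to_torus ` C)"
    by (rule sigma_compact_image[OF _ continuous_to_torus])
  have "AE x in lborel. x \<in> unit_cube \<longrightarrow> to_torus x \<in> E"
    using E(2) AE_haar_iff[of "\<lambda>w. w \<in> E"] E' by simp
  moreover have "AE x in lborel. x \<notin> N"
    using AE_not_in[OF N] by (simp add: AE_completion_iff)
  ultimately have "AE x in lborel. x \<in> unit_cube \<longrightarrow> to_torus x \<in> to_torus ` C"
    by eventually_elim (use B in \<open>auto simp: B_def\<close>)
  then have "AE w in haar. w \<in> to_torus ` C"
    using AE_haar_iff[of "\<lambda>w. w \<in> to_torus ` C"] sigma_compact_borel[OF sc] by simp
  then show ?thesis using sc B by (intro exI[of _ "to_torus ` C"]) (auto simp: B_def)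
qed

section \<open>Expansion along the leaves\<close>

text \<open>Approaching a point within an embedded compact set is the same as approaching the parameter,
  because the inverse of the parametrisation is continuous. This lets limits along a leaf be computed
  in any parametrisation.\<close>

lemma at_within_range_eq_filtermap:
  fixes \<gamma> :: "'a::t2_space \<Rightarrow> 'b::t2_space"
  assumes comp: "compact (UNIV :: 'a set)" and cont: "continuous_on UNIV \<gamma>" and inj: "inj \<gamma>"
  shows "at (\<gamma> t) within range \<gamma> = filtermap \<gamma> (at t)"
proof (rule antisym)
  let ?F = "at (\<gamma> t) within range \<gamma>"
  have cont_inv: "continuous_on (range \<gamma>) (inv \<gamma>)"
    by (rule continuous_on_inv[OF cont comp]) (use inj in auto)
  have "(inv \<gamma> \<longlongrightarrow> inv \<gamma> (\<gamma> t)) ?F"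
    using cont_inv unfolding continuous_on_def by blast
  moreover have "\<forall>\<^sub>F y in ?F. inv \<gamma> y \<noteq> t"
    unfolding eventually_at_filter by (intro always_eventually) (auto simp: inj)
  ultimately have "filterlim (inv \<gamma>) (at t) ?F"
    by (simp add: filterlim_at inj)
  then have "filtermap \<gamma> (filtermap (inv \<gamma>) ?F) \<le> filtermap \<gamma> (at t)"
    unfolding filterlim_def by (rule filtermap_mono)
  moreover have "filtermap \<gamma> (filtermap (inv \<gamma>) ?F) = ?F"
  proof -
    have "\<forall>\<^sub>F y in ?F. \<gamma> (inv \<gamma> y) = y"
      unfolding eventually_at_filter by (intro always_eventually) (auto simp: f_inv_into_f)
    then have "filtermap (\<lambda>y. \<gamma> (inv \<gamma> y)) ?F = filtermap (\<lambda>y. y) ?F"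
      unfolding filter_eq_iff eventually_filtermap
      by (intro allI) (rule eventually_subst, auto elim!: eventually_mono)
    then show ?thesis by (simp add: filtermap_filtermap)
  qed
  ultimately show "?F \<le> filtermap \<gamma> (at t)" by simp
  have "(\<gamma> \<longlongrightarrow> \<gamma> t) (at t)" using cont unfolding continuous_on_def by simp
  moreover have "\<forall>\<^sub>F s in at t. \<gamma> s \<in> range \<gamma> \<and> \<gamma> s \<noteq> \<gamma> t"
    unfolding eventually_at_filter by (intro always_eventually) (use inj in \<open>auto dest: injD\<close>)
  ultimately show "filtermap \<gamma> (at t) \<le> ?F"
    using filterlim_at[of \<gamma> "\<gamma> t" "range \<gamma>" "at t"] unfolding filterlim_def by blast
qed

lemma torus_has_derivative_id: "torus_has_derivative id id w"
proof -
  obtain x where "w = to_torus x" by (rule to_torus_cases)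
  then show ?thesis
    unfolding torus_has_derivative_def
    by (intro exI[of _ x] exI[of _ id]) (auto simp: id_def)
qed

lemma torus_has_derivative_funpow:
  fixes g :: "'n::finite torus \<Rightarrow> 'n torus"
  assumes "C2_torus g"
  shows "torus_has_derivative (g ^^ n) (torus_deriv (g ^^ n) w) w"
proof -
  have "\<exists>D. torus_has_derivative (g ^^ n) D w"
  proof (induction n)
    case 0
    show ?case unfolding funpow.simps by (rule exI, rule torus_has_derivative_id)
  next
    case (Suc n)
    then obtain D where "torus_has_derivative (g ^^ n) D w" by blast
    from torus_has_derivative_compose[OF this C2_torus_has_derivative[OF assms]]
    show ?case unfolding funpow.simps by blast
  qed
  then show ?thesis using torus_deriv_eqI by metis
qed

lemma torus_deriv_immersion:
  fixes \<gamma> :: "1 torus \<Rightarrow> 'n::finite torus"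
  assumes "C2_torus \<gamma>" "inj (torus_deriv \<gamma> t)"
  shows "torus_deriv \<gamma> t 1 \<noteq> 0"
proof -
  obtain x F where "(F has_derivative torus_deriv \<gamma> t) (at x)"
    using C2_torus_has_derivative[OF assms(1)] unfolding torus_has_derivative_def by blast
  then have "linear (torus_deriv \<gamma> t)"
    by (intro bounded_linear.linear has_derivative_bounded_linear)
  then have "torus_deriv \<gamma> t 0 = 0" by (rule linear_0)
  moreover have "torus_deriv \<gamma> t 1 \<noteq> torus_deriv \<gamma> t 0"
    using inj_eq[OF assms(2), of 1 0] by simp
  ultimately show ?thesis by simp
qed

text \<open>Seen from a point of the orbit, the expansion of the fibre is a ratio of successive speeds
  of the images of a parametrisation of the leaf; these ratios telescope.\<close>

lemma birkhoff_limit_expansion_ge: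
  fixes g :: "'n::finite torus \<Rightarrow> 'n torus" and \<pi> :: "'n torus \<Rightarrow> 'b::t2_space"
  assumes dyn: "fibred_dynamics g \<pi> L" and C2: "C2_torus g"
    and \<gamma>: "C2_circle_param \<gamma> (\<pi> -` {\<pi> w})" "\<gamma> t = w"
  defines "V \<equiv> \<lambda>n. norm (torus_deriv (g ^^ n) w (torus_deriv \<gamma> t 1))"
  shows "ln (V n) - ln (V 0) \<le> birkhoff_sum g (fibred_dynamics.limit_expansion g \<pi> L) n w"
proof -
  interpret fibred_dynamics g \<pi> L by (rule dyn)
  define q where "q n s = dist ((g ^^ n) (\<gamma> s)) ((g ^^ n) w) / dist s t" for n s
  have C2\<gamma>: "C2_torus \<gamma>" and inj\<gamma>: "inj \<gamma>" and range\<gamma>: "range \<gamma> = \<pi> -` {\<pi> w}"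
    and immersed: "inj (torus_deriv \<gamma> t)"
    using \<gamma>(1) unfolding C2_circle_param_def by auto
  have D\<gamma>: "torus_has_derivative \<gamma> (torus_deriv \<gamma> t) t" by (rule C2_torus_has_derivative[OF C2\<gamma>])
  have q_lim: "(q n \<longlongrightarrow> V n) (at t)" for n
  proof -
    have "torus_has_derivative ((g ^^ n) \<circ> \<gamma>) (torus_deriv (g ^^ n) w \<circ> torus_deriv \<gamma> t) t"
      by (rule torus_has_derivative_compose[OF D\<gamma>]) (simp add: \<gamma>(2) torus_has_derivative_funpow[OF C2])
    from torus_curve_speed[OF this] show ?thesis
      by (simp add: q_def[abs_def] V_def \<gamma>(2))
  qed
  have V0: "V 0 > 0"
  proof -
    have "torus_deriv \<gamma> t 1 \<noteq> 0" by (rule torus_deriv_immersion[OF C2\<gamma> immersed])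
    moreover have "torus_deriv (g ^^ 0) w = id"
      by (rule torus_deriv_eqI) (simp add: torus_has_derivative_id[unfolded id_def] id_def)
    ultimately show ?thesis by (simp add: V_def)
  qed
  have V_step: "V n \<le> L * V (Suc n)" for n
  proof (rule tendsto_le[OF _ _ q_lim])
    show "((\<lambda>s. L * q (Suc n) s) \<longlongrightarrow> L * V (Suc n)) (at t)"
      by (intro tendsto_mult_left q_lim)
    show "\<forall>\<^sub>F s in at t. q n s \<le> L * q (Suc n) s"
      unfolding q_def using lipschitz_inv_g
      by (intro always_eventually allI) (simp add: divide_right_mono)
  qed simp
  have V_pos: "V n > 0" for n
  proof (induction n)
    case (Suc n)
    then have "0 < L * V (Suc n)" using V_step[of n] by linarith
    then show ?case using L_ge_1 by (simp add: zero_less_mult_iff)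
  qed (rule V0)
  have step: "ln (V (Suc n)) - ln (V n) \<le> limit_expansion ((g ^^ n) w)" for n
  proof -
    let ?\<gamma> = "(g ^^ n) \<circ> \<gamma>" and ?u = "(g ^^ n) w"
    have u: "?\<gamma> t = ?u" using \<gamma>(2) by simp
    have "range ?\<gamma> = \<pi> -` {\<pi> ?u}"
    proof -
      have "g ` (\<pi> -` {\<pi> x}) = \<pi> -` {\<pi> (g x)}" for x
      proof (intro equalityI subsetI)
        fix y assume "y \<in> \<pi> -` {\<pi> (g x)}"
        then have "inv g y \<in> \<pi> -` {\<pi> x}" using fibre_iff[of "inv g y" x] by simp
        then show "y \<in> g ` (\<pi> -` {\<pi> x})" using g_inv_g[of y] by (metis imageI)
      qed (auto simp: fibre_iff)
      then have "(g ^^ n) ` (\<pi> -` {\<pi> w}) = \<pi> -` {\<pi> ((g ^^ n) w)}"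
      proof (induction n)
        case (Suc n)
        have "(g ^^ Suc n) ` (\<pi> -` {\<pi> w}) = g ` (g ^^ n) ` (\<pi> -` {\<pi> w})"
          by (simp only: funpow.simps image_comp)
        then show ?case using Suc by simp
      qed simp
      then show ?thesis unfolding image_comp[symmetric] range\<gamma> .
    qed
    moreover have "continuous_on UNIV ?\<gamma>"
    proof -
      have "continuous_on UNIV (g ^^ n)"
      proof (induction n)
        case (Suc n)
        show ?case unfolding funpow.simps
          by (intro continuous_on_compose Suc continuous_on_subset[OF continuous_g]) simp
      qed (simp add: id_def)
      then show ?thesis
        by (intro continuous_on_compose C2_torus_continuous[OF C2\<gamma>]) (auto elim: continuous_on_subset)
    qed
    moreover have "inj ?\<gamma>"
      by (intro inj_compose inj\<gamma>) (metis inj_on_inverseI inv_funpow_funpow)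
    ultimately have at_eq: "at ?u within \<pi> -` {\<pi> ?u} = filtermap ?\<gamma> (at t)"
      using at_within_range_eq_filtermap[OF compact_torus, of ?\<gamma> t] u by simp
    have "((\<lambda>s. ln (q (Suc n) s / q n s)) \<longlongrightarrow> ln (V (Suc n) / V n)) (at t)"
      using V_pos[of n] V_pos[of "Suc n"] by (intro tendsto_ln tendsto_divide q_lim) auto
    moreover have "\<forall>\<^sub>F s in at t. ln (q (Suc n) s / q n s) = log_ratio ?u (?\<gamma> s)"
      unfolding eventually_at_filter
      by (intro always_eventually) (auto simp: q_def log_ratio_def dist_commute)
    ultimately have "((\<lambda>s. log_ratio ?u (?\<gamma> s)) \<longlongrightarrow> ln (V (Suc n) / V n)) (at t)"
      by (rule Lim_transform_eventually)
    then have "(log_ratio ?u \<longlongrightarrow> ln (V (Suc n) / V n)) (at ?u within \<pi> -` {\<pi> ?u})"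
      unfolding at_eq filterlim_filtermap .
    then have "ln (V (Suc n) / V n) \<le> limit_expansion ?u"
      by (rule limit_expansion_ge) (simp add: at_eq filtermap_bot_iff)
    then show ?thesis using V_pos[of n] V_pos[of "Suc n"] by (simp add: ln_div)
  qed
  have "ln (V n) - ln (V 0) = (\<Sum>j<n. ln (V (Suc j)) - ln (V j))"
    by (rule sum_lessThan_telescope[symmetric])
  also have "\<dots> \<le> birkhoff_sum g limit_expansion n w"
    unfolding birkhoff_sum_def by (intro sum_mono step)
  finally show ?thesis .
qed

section \<open>Every leaf carries the same number of points\<close>

lemma inj_A2: "inj A2"
proof (rule injI)
  fix a b :: "2 torus" assume eq: "A2 a = A2 b"
  obtain x where a: "a = to_torus x" by (rule to_torus_cases)
  obtain y where b: "b = to_torus y" by (rule to_torus_cases)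
  let ?A = "vector [vector [2, 1], vector [1, 1]] :: real^2^2"
  have "\<forall>i. (?A *v x) $ i - (?A *v y) $ i \<in> \<int>"
    using eq unfolding a b A2.abs_eq to_torus_eq_iff .
  then have 1: "(2 * x $ 1 + x $ 2) - (2 * y $ 1 + y $ 2) \<in> \<int>"
    and 2: "(x $ 1 + x $ 2) - (y $ 1 + y $ 2) \<in> \<int>"
    by (auto simp: forall_2 matrix_vector_mult_def sum_2)
  have "x $ 1 - y $ 1 \<in> \<int>" using Ints_diff[OF 1 2] by (simp add: algebra_simps)
  moreover have "x $ 2 - y $ 2 \<in> \<int>"
    using Ints_diff[OF Ints_mult[OF Ints_numeral[of "num.Bit0 num.One"] 2] 1] by (simp add: algebra_simps)
  ultimately show "a = b" unfolding a b to_torus_eq_iff by (simp add: forall_2)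
qed

lemma infinite_circle: "infinite (range (\<gamma> :: 1 torus \<Rightarrow> 'b))" if "inj \<gamma>"
proof
  assume "finite (range \<gamma>)"
  then have "finite (UNIV :: 1 torus set)" using that by (rule finite_imageD)
  then have "open {t :: 1 torus}" for t
    by (metis finite_imp_closed finite_subset open_closed subset_UNIV)
  then show False using not_open_singleton by blast
qed

theorem theoremI:
  fixes g :: "3 torus \<Rightarrow> 3 torus"
    and \<pi> :: "3 torus \<Rightarrow> 2 torus"
    and W :: "3 torus set set"
    and lambda_c :: real
  assumes "g \<in> Diff2_haar"
    and "ergodic haar g"
    and "fibration \<pi>"
    and "\<pi> \<circ> g = A2 \<circ> \<pi>"
    and "W = fibres \<pi>"
    and "foliation_by_curves W"
    and "\<forall>L\<in>W. C2_circle L"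
    and "closure (\<Union>{L \<in> W. periodic_leaf g L}) = UNIV"
    and "lambda_c > 0"
    and "AE w in haar. \<forall>L\<in>W. w \<in> L \<longrightarrow> (\<forall>v\<in>circle_tangent_space L w. v \<noteq> 0 \<longrightarrow>
           (\<lambda>n. ln (norm (torus_deriv (g ^^ n) w v)) / real n) \<longlonglongrightarrow> lambda_c)"
  shows "\<exists>(S :: 3 torus set) (k :: nat). S \<in> sets (completion haar) \<and>
           (AE w in haar. w \<in> S) \<and> k \<ge> 1 \<and> (\<forall>L\<in>W. card (S \<inter> L) = k)"
proof -
  have bij: "bij g" and C2: "C2_torus g" "C2_torus (inv g)"
    using assms(1) by (auto simp: Diff2_haar_def)
  obtain L1 where L1: "L1 > 0" "\<And>a b. dist (g a) (g b) \<le> L1 * dist a b"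
    using C2_torus_lipschitz[OF C2(1)] by blast
  obtain L2 where L2: "L2 > 0" "\<And>a b. dist (inv g a) (inv g b) \<le> L2 * dist a b"
    using C2_torus_lipschitz[OF C2(2)] by blast
  define L where "L = max 1 (max L1 L2)"
  have dyn: "fibred_dynamics g \<pi> L"
  proof
    show "compact (UNIV :: 3 torus set)" by (rule compact_torus)
    show "dist (g a) (g b) \<le> L * dist a b" for a b
      by (rule order_trans[OF L1(2) mult_right_mono]) (auto simp: L_def)
    show "dist a b \<le> L * dist (g a) (g b)" for a b
    proof -
      have "dist a b = dist (inv g (g a)) (inv g (g b))" using bij by (simp add: bij_is_inj)
      also have "\<dots> \<le> L * dist (g a) (g b)"
        by (rule order_trans[OF L2(2) mult_right_mono]) (auto simp: L_def)
      finally show ?thesis .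
    qed
    show "continuous_on UNIV \<pi>" using assms(3) by (simp add: fibration_def)
    show "\<pi> (g a) = \<pi> (g b) \<longleftrightarrow> \<pi> a = \<pi> b" for a b
      using fun_cong[OF assms(4), of a] fun_cong[OF assms(4), of b] inj_eq[OF inj_A2] by simp
  qed (use bij in \<open>auto simp: L_def\<close>)
  interpret fibred_dynamics g \<pi> L by (rule dyn)
  interpret prob_space haar by (rule prob_space_haar)
  interpret ergodic_fibred_dynamics g \<pi> L haar
    by unfold_locales (rule sets_haar, rule assms(2))
  have leaf: "\<pi> -` {p} \<in> W" for p using assms(5) by (auto simp: fibres_def)
  have "AE w in haar. \<exists>a. (\<forall>n. a n \<le> birkhoff_sum g limit_expansion n w) \<and>
      (\<lambda>n. a n / real n) \<longlonglongrightarrow> lambda_c"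
    using assms(10)
  proof eventually_elim
    case (elim w)
    obtain \<gamma> where \<gamma>: "C2_circle_param \<gamma> (\<pi> -` {\<pi> w})"
      using assms(7) leaf unfolding C2_circle_def by blast
    then have "w \<in> range \<gamma>" unfolding C2_circle_param_def by simp
    then obtain t where t: "\<gamma> t = w" by blast
    define V where "V n = norm (torus_deriv (g ^^ n) w (torus_deriv \<gamma> t 1))" for n
    have le: "ln (V n) - ln (V 0) \<le> birkhoff_sum g limit_expansion n w" for n
      unfolding V_def by (rule birkhoff_limit_expansion_ge[OF dyn C2(1) \<gamma> t])
    have tangent: "torus_deriv \<gamma> t 1 \<in> circle_tangent_space (\<pi> -` {\<pi> w}) w"
      unfolding circle_tangent_space_def using \<gamma> t by blast
    have "torus_deriv \<gamma> t 1 \<noteq> 0"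
    proof -
      have "C2_torus \<gamma>" "inj (torus_deriv \<gamma> t)" using \<gamma> unfolding C2_circle_param_def by auto
      then show ?thesis using torus_deriv_immersion by blast
    qed
    then have "(\<lambda>n. ln (V n) / real n) \<longlonglongrightarrow> lambda_c"
      using elim leaf tangent unfolding V_def by blast
    then have "(\<lambda>n. ln (V n) / real n - ln (V 0) / real n) \<longlonglongrightarrow> lambda_c - 0"
      by (intro tendsto_diff lim_const_over_n)
    then have "(\<lambda>n. (ln (V n) - ln (V 0)) / real n) \<longlonglongrightarrow> lambda_c"
      by (simp add: diff_divide_distrib)
    then show ?case using le by (intro exI[of _ "\<lambda>n. ln (V n) - ln (V 0)"]) blast
  qed
  then obtain m where "0 < (\<integral>w. expansion m w \<partial>haar)"
    using positive_expansion_integral[OF assms(9)] by blast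
  then obtain S0 where "S0 \<in> sets haar" "AE w in haar. w \<in> S0" "\<And>p. finite (S0 \<inter> \<pi> -` {p})"
    using full_measure_finite_fibres by blast
  then obtain T k where T: "k \<ge> 1" "AE w in haar. w \<in> T" "AE w in haar. card (T \<inter> \<pi> -` {\<pi> w}) = k"
    using constant_fibre_card[OF _ _ _ haar_inner_sigma_compact] by metis
  \<comment> \<open>Replacement points for the fibres that \<open>T\<close> meets in a number of points other than \<open>k\<close>. All points
    of these fibres form a null set, so the choice affects measurability only up to completion.\<close>
  have "\<forall>p. \<exists>X\<subseteq>\<pi> -` {p}. card X = k"
  proof
    fix p
    obtain \<gamma> where "C2_circle_param \<gamma> (\<pi> -` {p})"
      using assms(7) leaf unfolding C2_circle_def by blast
    then have "infinite (\<pi> -` {p})"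
      using infinite_circle unfolding C2_circle_param_def by metis
    then show "\<exists>X\<subseteq>\<pi> -` {p}. card X = k" by (meson infinite_arbitrarily_large)
  qed
  then obtain X where X: "\<And>p. X p \<subseteq> \<pi> -` {p}" "\<And>p. card (X p) = k" by metis
  define S where "S = {w. w \<in> (if card (T \<inter> \<pi> -` {\<pi> w}) = k then T else X (\<pi> w))}"
  have "S \<inter> \<pi> -` {p} = (if card (T \<inter> \<pi> -` {p}) = k then T \<inter> \<pi> -` {p} else X p)" for p
    using X(1)[of p] by (auto simp: S_def split: if_splits)
  then have "card (S \<inter> \<pi> -` {p}) = k" for p using X(2) by simp
  then have card_S: "\<forall>L\<in>W. card (S \<inter> L) = k" using assms(5) by (auto simp: fibres_def)
  have AE_S: "AE w in haar. w \<in> S" using T(2,3) by eventually_elim (simp add: S_def)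
  have "{w \<in> space (completion haar). w \<in> S} \<in> sets (completion haar)"
  proof -
    have "AE w in haar. \<not> w \<notin> S" using AE_S by simp
    then have "Measurable.pred (completion haar) (\<lambda>w. w \<notin> S)" by (rule sets_completion_AE)
    then have "Measurable.pred (completion haar) (\<lambda>w. \<not> w \<notin> S)" by (rule pred_intros_logic)
    then show ?thesis unfolding pred_def by simp
  qed
  then have "S \<in> sets (completion haar)" by (simp add: space_M)
  then show ?thesis using AE_S T(1) card_S by blast
qed

end
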